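(* For every finite Abelian group $G$ not isomorphic to $\mathbb{Z}_4$, the lattice $\mathcal{L}(G)$ has a basis of minimal vectors, i.e. $\mathcal{S}(G)$ contains $n$ vectors such that every vector of $\mathcal{L}(G)$ is an integer linear combination of these $n$ vectors.
   Context: Let $G=\{0,g_1,\dots,g_n\}$ be a finite Abelian (additive) group of order $n+1$, with its nonzero elements listed as $g_1,\dots,g_n$. Define $$\mathcal{L}(G)=\Big\{X=(x_1,\dots,x_n,-x_1-\cdots-x_n)\in\mathbb{Z}^{n+1}:\ x_1g_1+\cdots+x_ng_n=0\Big\},$$ a lattice of rank $n$. Let $\|\cdot\|$ be the Euclidean norm, $d(G)=\min\{\|X\|: X\in\mathcal{L}(G)\setminus\{0\}\}$, and $\mathcal{S}(G)=\{X\in\mathcal{L}(G):\|X\|=d(G)\}$ the set of minimal vectors. $\mathbb{Z}_m$ denotes the cyclic group of order $m$. *)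

theory Defs
  imports "HOL-Analysis.L2_Norm" "HOL-Algebra.FiniteProduct" "HOL-Algebra.Elementary_Groups"
begin

text \<open>
  The group is a commutative group of HOL-Algebra, hence written multiplicatively: the zero element
  is \<open>\<one>\<^bsub>G\<^esub>\<close> and the multiple \<open>x g\<close> is \<open>g [^]\<^bsub>G\<^esub> x\<close> with \<open>x :: int\<close>.
  The dimension \<open>n + 1\<close> depends on the group, so a vector in the integer lattice of that dimension
  is a function \<open>nat \<Rightarrow> int\<close> with coordinates at \<open>1, \<dots>, n + 1\<close>, and zero elsewhere.
\<close>

definition int_vectors :: "nat \<Rightarrow> (nat \<Rightarrow> int) set" where
  "int_vectors m = {X. \<forall>i. i \<notin> {1..m} \<longrightarrow> X i = 0}"

definition group_lattice :: "('a, 'b) monoid_scheme \<Rightarrow> nat \<Rightarrow> (nat \<Rightarrow> 'a) \<Rightarrow> (nat \<Rightarrow> int) set" where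
  "group_lattice G n g =
     {X \<in> int_vectors (n + 1).
        X (n + 1) = - (\<Sum>i=1..n. X i) \<and>
        (\<Otimes>\<^bsub>G\<^esub>i\<in>{1..n}. g i [^]\<^bsub>G\<^esub> X i) = \<one>\<^bsub>G\<^esub>}"

definition euclidean_norm :: "nat \<Rightarrow> (nat \<Rightarrow> int) \<Rightarrow> real" where
  "euclidean_norm m X = L2_set (\<lambda>i. real_of_int (X i)) {1..m}"

text \<open>
  For the trivial group (\<open>n = 0\<close>) the lattice is zero and the minimum below is an unspecified real.
\<close>

definition min_distance :: "('a, 'b) monoid_scheme \<Rightarrow> nat \<Rightarrow> (nat \<Rightarrow> 'a) \<Rightarrow> real" where
  "min_distance G n g =
     (LEAST d. d \<in> euclidean_norm (n + 1) ` (group_lattice G n g - {\<lambda>_. 0}))"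

definition minimal_vectors :: "('a, 'b) monoid_scheme \<Rightarrow> nat \<Rightarrow> (nat \<Rightarrow> 'a) \<Rightarrow> (nat \<Rightarrow> int) set" where
  "minimal_vectors G n g =
     {X \<in> group_lattice G n g. euclidean_norm (n + 1) X = min_distance G n g}"

end

(*
  Let phi(a) = e_a - e_1, the coordinate at the identity being the last one; phi(1) = 0. For a set R
  of relations ab = cd let M be the span of the vectors phi(a) + phi(b) - phi(c) - phi(d). If phi is
  additive modulo M, then every X in the lattice is congruent to phi applied to the product of the
  g_i^(X_i), that is, to phi(1) = 0, and M is the whole lattice. When a, b, c, d are distinct the
  vector has norm 2, which is the minimum once |G| >= 4. As the lattice has rank n, it suffices to
  find such an R with at most n elements.

  Call a subgroup H well presented if |H| - 1 relations among distinct elements of H make phi additive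
  on H. A well-presented H with |H| >= 3 stays so when an element is adjoined, hence one well-presented
  subgroup of order at least 3 is enough. Cyclic groups of order >= 5, the Klein group and Z_3 x Z_3
  are well presented, and every finite abelian group of order >= 4 other than Z_4 contains one of
  these. The groups of order at most 3 have the same kind of basis with repeated elements allowed in
  the relations.
*)
theory Submission
  imports Defs "HOL-Library.Function_Algebras" "HOL-Algebra.Multiplicative_Group"
    "HOL-Computational_Algebra.Primes"
begin

section \<open>Powers of an element and translates of a subgroup\<close>

text \<open>Powers of \<open>t\<close> depend only on the exponent modulo \<open>ord t\<close>, so
  exponentiation is a homomorphism on residues. This turns an element of order 4 whose powers
  exhaust the group into the excluded isomorphism with Z_4.\<close>

lemma (in group) iso_integer_mod_group:
  assumes t: "t \<in> carrier G" and gen: "carrier G = (\<lambda>j::nat. t [^] j) ` {..<m}" and m: "ord t = m" "0 < m"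
  shows "G \<cong> integer_mod_group m"
proof -
  let ?h = "\<lambda>k::int. t [^] k"
  have "?h \<in> hom (integer_mod_group m) G"
  proof (rule homI)
    fix x y
    show "?h (x \<otimes>\<^bsub>integer_mod_group m\<^esub> y) = ?h x \<otimes> ?h y"
      using t m by (simp add: int_pow_mult[symmetric] int_pow_eq mod_eq_dvd_iff[symmetric])
  qed (use t in auto)
  moreover have "inj_on ?h (carrier (integer_mod_group m))"
  proof (rule inj_onI)
    fix x y assume xy: "x \<in> carrier (integer_mod_group m)" "y \<in> carrier (integer_mod_group m)" "?h x = ?h y"
    then have "int m dvd x - y" using t m by (simp add: int_pow_eq dvd_diff_commute)
    then have "x mod int m = y mod int m" by (simp add: mod_eq_dvd_iff)
    then show "x = y" using xy m by (simp add: carrier_integer_mod_group)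
  qed
  moreover have "?h ` carrier (integer_mod_group m) = carrier G"
  proof
    show "?h ` carrier (integer_mod_group m) \<subseteq> carrier G" using t by auto
    show "carrier G \<subseteq> ?h ` carrier (integer_mod_group m)"
    proof
      fix a assume "a \<in> carrier G"
      then obtain j where j: "j < m" "a = t [^] j" using gen by auto
      then have "a = ?h (int j)" "int j \<in> carrier (integer_mod_group m)"
        using m by (auto simp: carrier_integer_mod_group int_pow_int)
      then show "a \<in> ?h ` carrier (integer_mod_group m)" by blast
    qed
  qed
  ultimately have "?h \<in> iso (integer_mod_group m) G" by (simp add: iso_def bij_betw_def)
  then have "integer_mod_group m \<cong> G" by (auto simp: is_iso_def)
  then show ?thesis by (simp add: group.iso_sym)
qed

lemma (in group) mult_notin_subgroup:
  assumes "subgroup H G" "h \<in> H" "y \<in> carrier G" "y \<notin> H"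
  shows "h \<otimes> y \<notin> H"
proof
  assume "h \<otimes> y \<in> H"
  then have "inv h \<otimes> (h \<otimes> y) \<in> H" using assms by (simp add: subgroup.m_closed subgroup.m_inv_closed)
  then show False using assms subgroup.mem_carrier[OF assms(1)] by (simp add: m_assoc[symmetric])
qed

section \<open>Additivity modulo a submodule\<close>

text \<open>Abstract stand-in for phi: any map \<open>f\<close> from a finite abelian group to a
  module over the integers that vanishes at the identity. Presenting subgroups by few relations
  involves no coordinates.\<close>

locale labelled_group = comm_group G + Modules.module scale
  for G :: "('a, 'b) monoid_scheme" (structure)
    and scale :: "int \<Rightarrow> 'v::ab_group_add \<Rightarrow> 'v" (infixr \<open>*s\<close> 75) +
  fixes f :: "'a \<Rightarrow> 'v"
  assumes finite_carrier: "finite (carrier G)"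
    and f_one: "f \<one> = 0"
begin

text \<open>For a subgroup \<open>H\<close> and a submodule \<open>M\<close> this says that
  \<open>f\<close> induces a homomorphism from \<open>H\<close> to the quotient by
  \<open>M\<close>.\<close>

definition additive_mod :: "'v set \<Rightarrow> 'a set \<Rightarrow> bool" where
  "additive_mod M H \<longleftrightarrow> (\<forall>a\<in>H. \<forall>b\<in>H. f a + f b - f (a \<otimes> b) \<in> M)"

text \<open>If \<open>m > 0\<close> and \<open>t^m\<close> lies in the subgroup \<open>H\<close>,
  this is the subgroup generated by \<open>H\<close> and \<open>t\<close>; if \<open>m\<close> is
  the least such exponent, the representation of its elements is unique.\<close>

definition adjoin :: "'a set \<Rightarrow> 'a \<Rightarrow> nat \<Rightarrow> 'a set" where
  "adjoin H t m = (\<lambda>(h, j). h \<otimes> t [^] j) ` (H \<times> {..<m})"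

lemma adjoin_memI: "h \<in> H \<Longrightarrow> j < m \<Longrightarrow> h \<otimes> t [^] j \<in> adjoin H t m"
  by (auto simp: adjoin_def)

lemma mult_pow_wrap:
  assumes "h \<in> carrier G" "t \<in> carrier G" "m \<le> j"
  shows "h \<otimes> t [^] (j::nat) = (h \<otimes> t [^] m) \<otimes> t [^] (j - m)"
  using assms by (simp add: m_assoc nat_pow_mult)

lemma mult_pow_mult:
  assumes "h \<in> carrier G" "k \<in> carrier G" "t \<in> carrier G"
  shows "(h \<otimes> t [^] (i::nat)) \<otimes> (k \<otimes> t [^] (j::nat)) = (h \<otimes> k) \<otimes> t [^] (i + j)"
proof -
  have "(h \<otimes> t [^] i) \<otimes> (k \<otimes> t [^] j) = (h \<otimes> k) \<otimes> (t [^] i \<otimes> t [^] j)"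
    using assms by (simp add: m_ac)
  then show ?thesis using assms by (simp add: nat_pow_mult)
qed

text \<open>The range \<open>j < 2 * m\<close> covers the exponent sums arising in products;
  absorbing one factor \<open>t^m\<close> into \<open>H\<close> brings them below
  \<open>m\<close>.\<close>

lemma adjoin_memI':
  assumes "subgroup H G" "t \<in> carrier G" "t [^] m \<in> H" "h \<in> H" "j < 2 * m"
  shows "h \<otimes> t [^] j \<in> adjoin H t m"
proof (cases "j < m")
  case False
  have "h \<in> carrier G" using assms subgroup.mem_carrier by metis
  then have "h \<otimes> t [^] j = (h \<otimes> t [^] m) \<otimes> t [^] (j - m)"
    using assms(2) False by (intro mult_pow_wrap) auto
  moreover have "h \<otimes> t [^] m \<in> H" using assms by (simp add: subgroup.m_closed)
  moreover have "j - m < m" using assms(5) False by linarith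
  ultimately show ?thesis by (simp add: adjoin_memI)
qed (use assms adjoin_memI in auto)

lemma subgroup_adjoin:
  assumes H: "subgroup H G" and t: "t \<in> carrier G" and m: "0 < m" and tm: "t [^] m \<in> H"
  shows "subgroup (adjoin H t m) G"
proof (rule subgroupI)
  note hc = subgroup.mem_carrier[OF H]
  show "adjoin H t m \<subseteq> carrier G"
    using t hc by (auto simp: adjoin_def)
  have "\<one> \<otimes> t [^] (0::nat) \<in> adjoin H t m"
    using H m by (intro adjoin_memI) (auto simp: subgroup.one_closed)
  then show "adjoin H t m \<noteq> {}" by auto
  fix a assume "a \<in> adjoin H t m"
  then obtain h i where *: "a = h \<otimes> t [^] i" "h \<in> H" "i < m"
    by (auto simp: adjoin_def)
  \<comment> \<open>The inverse of \<open>t^i\<close> is the inverse of \<open>t^m\<close>, which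
    lies in \<open>H\<close>, times \<open>t^(m - i)\<close>. This exponent is nonnegative, but
    equals \<open>m\<close> when \<open>i = 0\<close>.\<close>
  let ?k = "inv h \<otimes> inv (t [^] m)"
  have k: "?k \<in> H" using * tm H by (simp add: subgroup.m_closed subgroup.m_inv_closed)
  have "(?k \<otimes> t [^] (m - i)) \<otimes> a = (?k \<otimes> h) \<otimes> t [^] m"
    using * t hc k by (simp add: mult_pow_mult)
  also have "\<dots> = (inv h \<otimes> h) \<otimes> (inv (t [^] m) \<otimes> t [^] m)"
    using * t hc by (simp add: m_ac)
  also have "\<dots> = \<one>" using * t hc by simp
  finally have "inv a = ?k \<otimes> t [^] (m - i)"
    using * t hc k by (intro inv_equality) auto
  then show "inv a \<in> adjoin H t m"
    using adjoin_memI'[OF H t tm k, of "m - i"] * by simp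
next
  note hc = subgroup.mem_carrier[OF H]
  fix a b assume "a \<in> adjoin H t m" "b \<in> adjoin H t m"
  then obtain h i k j where *: "a = h \<otimes> t [^] i" "b = k \<otimes> t [^] j" "h \<in> H" "k \<in> H" "i < m" "j < m"
    by (auto simp: adjoin_def)
  have "a \<otimes> b = (h \<otimes> k) \<otimes> t [^] (i + j)"
    using * t hc by (simp add: mult_pow_mult)
  then show "a \<otimes> b \<in> adjoin H t m"
    using adjoin_memI'[OF H t tm, of "h \<otimes> k" "i + j"] * H by (simp add: subgroup.m_closed)
qed

text \<open>If \<open>h t^i = k t^j\<close> with \<open>i <= j\<close>, then
  \<open>t^(j - i)\<close> lies in \<open>H\<close>, so \<open>i = j\<close> by
  \<open>least\<close>; distinct pairs therefore give distinct elements.\<close>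

lemma card_adjoin:
  assumes H: "subgroup H G" and t: "t \<in> carrier G"
    and least: "\<forall>j. 0 < j \<longrightarrow> j < m \<longrightarrow> t [^] j \<notin> H"
  shows "card (adjoin H t m) = card H * m"
proof -
  note nm = least[rule_format]
  note hc = subgroup.mem_carrier[OF H]
  have aux: "h = k \<and> i = j"
    if "h \<otimes> t [^] i = k \<otimes> t [^] j" "h \<in> H" "k \<in> H" "j < m" "i \<le> j" for h k and i j :: nat
  proof -
    have "k \<otimes> t [^] j = (k \<otimes> t [^] (j - i)) \<otimes> t [^] i"
      using that hc t by (simp add: m_assoc nat_pow_mult)
    then have eq: "h = k \<otimes> t [^] (j - i)"
      using that hc t by simp
    then have "t [^] (j - i) = inv k \<otimes> h"
      using that hc t by (simp add: m_assoc[symmetric])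
    then have "t [^] (j - i) \<in> H" using that H by (simp add: subgroup.m_closed subgroup.m_inv_closed)
    then have "i = j" using nm[of "j - i"] that by (cases "i < j") auto
    then show ?thesis using eq that hc by simp
  qed
  have "inj_on (\<lambda>(h, j). h \<otimes> t [^] j) (H \<times> {..<m})"
  proof (rule inj_onI)
    fix x y
    assume xy: "x \<in> H \<times> {..<m}" "y \<in> H \<times> {..<m}"
      and eq: "(\<lambda>(h, j). h \<otimes> t [^] j) x = (\<lambda>(h, j). h \<otimes> t [^] j) y"
    obtain h i k j where [simp]: "x = (h, i)" "y = (k, j)" by fastforce
    have "i \<le> j \<or> j \<le> i" by linarith
    then show "x = y"
      using aux[of h i k j] aux[of k j h i] xy eq[symmetric] eq by fastforce
  qed
  then show ?thesis by (simp add: adjoin_def card_image card_cartesian_product)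
qed

text \<open>Modulo \<open>M\<close> the hypotheses force \<open>f (h t^j)\<close> to be
  \<open>f h\<close> plus \<open>j\<close> times \<open>f t\<close>. Once known for all
  \<open>j < 2 * m\<close>, this formula applies to two factors and to their product, and additivity
  on \<open>H\<close> finishes.\<close>

lemma additive_mod_adjoin:
  assumes H: "subgroup H G" and t: "t \<in> carrier G" and tm: "t [^] m \<in> H"
    and M: "subspace M" and add: "additive_mod M H"
    and coset: "\<And>h j. h \<in> H \<Longrightarrow> 0 < j \<Longrightarrow> j < m \<Longrightarrow> f h + f (t [^] j) - f (h \<otimes> t [^] j) \<in> M"
    and pow: "\<And>j. 0 < j \<Longrightarrow> j < m \<Longrightarrow> f (t [^] j) + f t - f (t [^] Suc j) \<in> M"
  shows "additive_mod M (adjoin H t m)"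
proof -
  note hc = subgroup.mem_carrier[OF H]
  note mc = subspace_0[OF M] subspace_add[OF M] subspace_diff[OF M] subspace_neg[OF M]
  \<comment> \<open>The exponent \<open>m\<close> itself is included because \<open>r\<close> needs
    the value of \<open>f\<close> at \<open>t^m\<close>.\<close>
  have p: "f (t [^] j) - int j *s f t \<in> M" if "j \<le> m" for j
    using that
  proof (induction j)
    case 0
    then show ?case by (simp add: f_one mc)
  next
    case (Suc j)
    show ?case
    proof (cases "j = 0")
      case True
      then show ?thesis using t by (simp add: mc)
    next
      case False
      then have a: "f (t [^] j) - int j *s f t \<in> M" and b: "f (t [^] j) + f t - f (t [^] Suc j) \<in> M"
        using Suc pow by auto
      show ?thesis
        using mc(3)[OF a b] by (simp add: scale_left_distrib algebra_simps)
    qed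
  qed
  have q: "f (h \<otimes> t [^] j) - (f h + int j *s f t) \<in> M" if "j < m" "h \<in> H" for h j
  proof (cases "j = 0")
    case True
    then show ?thesis using hc that by (simp add: mc)
  next
    case False
    show ?thesis
      using mc(3)[OF p[of j] coset[of h j]] that False by (simp add: algebra_simps)
  qed
  \<comment> \<open>For \<open>m <= j\<close> the element \<open>h t^m\<close> of \<open>H\<close>
    takes the place of \<open>h\<close>; \<open>add\<close> splits off \<open>f (t^m)\<close>, which
    \<open>p\<close> replaces by \<open>m\<close> times \<open>f t\<close>.\<close>
  have r: "f (h \<otimes> t [^] j) - (f h + int j *s f t) \<in> M" if "j < 2 * m" "h \<in> H" for h j
  proof (cases "j < m")
    case False
    then have jm: "j - m < m" "j = m + (j - m)" using that by auto
    let ?k = "h \<otimes> t [^] m"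
    have "?k \<in> H" using that tm H by (simp add: subgroup.m_closed)
    then have a: "f (?k \<otimes> t [^] (j - m)) - (f ?k + int (j - m) *s f t) \<in> M"
      using q jm by blast
    have b: "f h + f (t [^] m) - f ?k \<in> M"
      using add that tm by (simp add: additive_mod_def)
    have e: "h \<otimes> t [^] j = ?k \<otimes> t [^] (j - m)"
      using False hc that t by (intro mult_pow_wrap) auto
    have s: "int j *s f t = int m *s f t + int (j - m) *s f t"
      using jm(2) by (metis of_nat_add scale_left_distrib)
    show ?thesis
      using mc(2)[OF mc(3)[OF a b] p[OF order_refl]] unfolding e s by (simp add: algebra_simps)
  qed (use q that in auto)
  show ?thesis unfolding additive_mod_def
  proof (intro ballI)
    fix a b assume "a \<in> adjoin H t m" "b \<in> adjoin H t m"
    then obtain h i k j where *: "a = h \<otimes> t [^] i" "b = k \<otimes> t [^] j" "h \<in> H" "k \<in> H" "i < m" "j < m"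
      by (auto simp: adjoin_def)
    have e: "a \<otimes> b = (h \<otimes> k) \<otimes> t [^] (i + j)"
      using * t hc by (simp add: mult_pow_mult)
    have 1: "f a - (f h + int i *s f t) \<in> M" "f b - (f k + int j *s f t) \<in> M"
      using r * by auto
    have 2: "f (a \<otimes> b) - (f (h \<otimes> k) + int (i + j) *s f t) \<in> M"
      unfolding e using r[of "i + j" "h \<otimes> k"] * H by (simp add: subgroup.m_closed)
    have 3: "f h + f k - f (h \<otimes> k) \<in> M" using add * by (simp add: additive_mod_def)
    show "f a + f b - f (a \<otimes> b) \<in> M"
      using mc(2)[OF mc(3)[OF mc(2)[OF 1] 2] 3] by (simp add: scale_left_distrib algebra_simps)
  qed
qed


section \<open>Well-presented subgroups\<close>

definition relations :: "'a set \<Rightarrow> ('a \<times> 'a \<times> 'a \<times> 'a) set" where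
  "relations A = {(a, b, c, d). {a, b, c, d} \<subseteq> A \<and> distinct [a, b, c, d] \<and> a \<otimes> b = c \<otimes> d}"

text \<open>For \<open>f = diff_vector\<close> the subtracted unit vectors of the identity cancel,
  leaving e_a + e_b - e_c - e_d.\<close>

fun relation_vector :: "'a \<times> 'a \<times> 'a \<times> 'a \<Rightarrow> 'v" where
  "relation_vector (a, b, c, d) = f a + f b - f c - f d"

definition well_presented :: "'a set \<Rightarrow> bool" where
  "well_presented H \<longleftrightarrow> subgroup H G \<and>
     (\<exists>R \<subseteq> relations H. card R < card H \<and> additive_mod (span (relation_vector ` R)) H)"

lemma finite_relations: "A \<subseteq> carrier G \<Longrightarrow> finite (relations A)"
proof -
  assume "A \<subseteq> carrier G"
  then have "finite (A \<times> A \<times> A \<times> A)" using finite_carrier finite_subset by blast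
  then show ?thesis by (rule finite_subset[rotated]) (auto simp: relations_def)
qed

lemma relations_mono: "A \<subseteq> B \<Longrightarrow> relations A \<subseteq> relations B"
  unfolding relations_def by fast

lemma additive_mod_mono: "additive_mod M H \<Longrightarrow> M \<subseteq> N \<Longrightarrow> additive_mod N H"
  by (auto simp: additive_mod_def)

lemma finite_subgroup: "subgroup H G \<Longrightarrow> finite H"
  using finite_carrier finite_subset subgroup.subset by metis

lemma subset_adjoin:
  assumes "subgroup H G" "t \<in> carrier G" "0 < m"
  shows "H \<subseteq> adjoin H t m"
proof
  fix h assume "h \<in> H"
  then have "h = h \<otimes> t [^] (0::nat)" using assms subgroup.mem_carrier by fastforce
  then show "h \<in> adjoin H t m" using adjoin_memI[OF \<open>h \<in> H\<close> assms(3)] by metis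
qed

lemma mem_adjoin:
  assumes "subgroup H G" "t \<in> carrier G" "0 < m" "t [^] m \<in> H"
  shows "t \<in> adjoin H t m"
proof -
  have "t = \<one> \<otimes> t [^] (1::nat)" using assms by simp
  then show ?thesis using adjoin_memI'[OF assms(1,2,4), of \<one> 1] assms subgroup.one_closed[OF assms(1)] by auto
qed

lemma least_power:
  assumes "subgroup H G" "t \<in> carrier G"
  shows "\<exists>m::nat. 0 < m \<and> t [^] m \<in> H \<and> (\<forall>j. 0 < j \<longrightarrow> j < m \<longrightarrow> t [^] j \<notin> H)"
proof -
  define m :: nat where "m = (LEAST m. 0 < m \<and> t [^] m \<in> H)"
  have "0 < ord t \<and> t [^] ord t \<in> H"
    using assms finite_carrier ord_ge_1[of t] subgroup.one_closed by fastforce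
  then have "0 < m \<and> t [^] m \<in> H" unfolding m_def by (rule LeastI)
  moreover have "t [^] j \<notin> H" if "0 < j" "j < m" for j
    using not_less_Least[OF that(2)[unfolded m_def]] that by auto
  ultimately show ?thesis by blast
qed

text \<open>The count is the point: one relation for each pair of a nontrivial \<open>h\<close> and
  \<open>0 < j < m\<close>, and one more for each such \<open>j\<close>, hence at most as many as
  the order grows. Since \<open>card H\<close> is at least 3, \<open>H\<close> has an element
  besides the identity and \<open>t^m\<close>. The coset conclusion does not presuppose additivity
  on \<open>H\<close>; for Z_3 x Z_3 it serves to prove that additivity.\<close>

lemma adjoin_relations:
  assumes H: "subgroup H G" and card: "3 \<le> card H" and t: "t \<in> carrier G"
    and m: "0 < m" and tm: "t [^] m \<in> H"
    and least: "\<forall>j. 0 < j \<longrightarrow> j < m \<longrightarrow> t [^] j \<notin> H"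
  shows "\<exists>S \<subseteq> relations (adjoin H t m). card S \<le> card H * (m - 1) \<and>
    (\<forall>M. subspace M \<longrightarrow> relation_vector ` S \<subseteq> M \<longrightarrow>
      (\<forall>h\<in>H. \<forall>j<m. f h + f (t [^] j) - f (h \<otimes> t [^] j) \<in> M)) \<and>
    (\<forall>M. subspace M \<longrightarrow> relation_vector ` S \<subseteq> M \<longrightarrow>
      additive_mod M H \<longrightarrow> additive_mod M (adjoin H t m))"
proof -
  note nm = least[rule_format]
  note hc = subgroup.mem_carrier[OF H]
  note finH = finite_subgroup[OF H]
  have "\<not> H \<subseteq> {\<one>, t [^] m}"
  proof
    assume "H \<subseteq> {\<one>, t [^] m}"
    then have "card H \<le> card {\<one>, t [^] m}" by (intro card_mono) auto
    also have "\<dots> \<le> 2" by (simp add: card_insert_if)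
    finally show False using card by simp
  qed
  then obtain k where k: "k \<in> H" "k \<noteq> \<one>" "k \<noteq> t [^] m" by blast
  \<comment> \<open>The relations in \<open>S1\<close> give additivity on the products \<open>h t^j\<close>. Modulo these, the relation
    \<open>(k t) t^j = k t^(j + 1)\<close> of \<open>S2\<close> amounts to additivity on \<open>t^j t\<close>; the factor \<open>k\<close> keeps its
    four entries distinct when \<open>j = 1\<close> (by \<open>k \<noteq> \<one>\<close>) and when \<open>j = m - 1\<close> (by \<open>k \<noteq> t^m\<close>).\<close>
  define S1 where "S1 = (\<lambda>(h, j). (h \<otimes> t [^] j, \<one>, h, t [^] j)) ` ((H - {\<one>}) \<times> {1..<m})"
  define S2 where "S2 = (\<lambda>j. (k \<otimes> t, t [^] j, k, t [^] Suc j)) ` {1..<m}"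
  have one: "\<one> \<in> H" using H by (rule subgroup.one_closed)
  have tj: "t [^] j \<in> adjoin H t m" if "j < 2 * m" for j :: nat
    using adjoin_memI'[OF H t tm one that] t by simp
  have out: "h \<otimes> t [^] j \<notin> H" if "h \<in> H" "0 < j" "j < m" for h j
    using mult_notin_subgroup[OF H that(1) _ nm[OF that(2,3)]] t by simp
  have cancel: "h = \<one>" if "h \<in> carrier G" "x \<in> carrier G" "h \<otimes> x = x" for h x
    using that by simp
  have coset: "f h + f (t [^] j) - f (h \<otimes> t [^] j) \<in> M"
    if M: "subspace M" and S: "relation_vector ` (S1 \<union> S2) \<subseteq> M" and h: "h \<in> H" and j: "j < m" for M h j
  proof (cases "h = \<one> \<or> j = 0")
    case True
    then show ?thesis using subspace_0[OF M] f_one t hc[OF h] by auto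
  next
    case False
    then have "(h \<otimes> t [^] j, \<one>, h, t [^] j) \<in> S1"
      using h j by (force simp: S1_def)
    then have "relation_vector (h \<otimes> t [^] j, \<one>, h, t [^] j) \<in> M" using S by blast
    from subspace_neg[OF M this] show ?thesis using f_one by (simp add: algebra_simps)
  qed
  show ?thesis
  proof (rule exI[of _ "S1 \<union> S2"], intro conjI allI impI ballI)
    have "S1 \<subseteq> relations (adjoin H t m)"
    proof -
      have "(h \<otimes> t [^] j, \<one>, h, t [^] j) \<in> relations (adjoin H t m)"
        if "h \<in> H" "h \<noteq> \<one>" "0 < j" "j < m" for h j
      proof -
        have "{h \<otimes> t [^] j, \<one>, h, t [^] j} \<subseteq> adjoin H t m"
          using that one subset_adjoin[OF H t m] tj[of j] adjoin_memI[of h H j m t] by auto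
        moreover have "distinct [h \<otimes> t [^] j, \<one>, h, t [^] j]"
          using out[OF that(1,3,4)] nm[OF that(3,4)] one that cancel[of h "t [^] j"] hc t by auto
        ultimately show ?thesis using that hc t by (simp add: relations_def)
      qed
      then show ?thesis by (force simp: S1_def)
    qed
    moreover have "S2 \<subseteq> relations (adjoin H t m)"
    proof -
      have "(k \<otimes> t, t [^] j, k, t [^] Suc j) \<in> relations (adjoin H t m)"
        if "0 < j" "j < m" for j
      proof -
        have m1: "1 < m" using that by linarith
        have kt: "k \<otimes> t \<in> adjoin H t m" "k \<otimes> t \<notin> H"
          using adjoin_memI[OF k(1) m1, of t] out[OF k(1) _ m1] t by auto
        have "{k \<otimes> t, t [^] j, k, t [^] Suc j} \<subseteq> adjoin H t m"
          using that kt k tj[of j] tj[of "Suc j"] subset_adjoin[OF H t m] by auto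
        moreover have "k \<otimes> t \<noteq> t [^] j"
        proof
          assume e: "k \<otimes> t = t [^] j"
          have "t [^] j = t [^] (j - 1) \<otimes> t" using that(1) by (cases j) auto
          then have "k = t [^] (j - 1)" using e t k hc by simp
          then show False using nm[of "j - 1"] that k by (cases "j = 1") auto
        qed
        moreover have "k \<otimes> t \<noteq> t [^] Suc j"
        proof
          assume "k \<otimes> t = t [^] Suc j"
          then have "k = t [^] j" using t k hc by simp
          then show False using nm[OF that] k by simp
        qed
        moreover have "t [^] j \<noteq> t [^] Suc j"
        proof
          assume "t [^] j = t [^] Suc j"
          then have "t = \<one>" using t by simp
          then show False using nm[OF that] one by simp
        qed
        moreover have "k \<noteq> t [^] Suc j"
          using nm[of "Suc j"] k that by (cases "Suc j = m") auto
        moreover have "(k \<otimes> t) \<otimes> t [^] j = k \<otimes> t [^] Suc j"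
          using t k hc by (simp add: m_ac)
        ultimately show ?thesis using kt(2) nm[OF that] k(1) by (auto simp: relations_def)
      qed
      then show ?thesis by (auto simp: S2_def)
    qed
    ultimately show "S1 \<union> S2 \<subseteq> relations (adjoin H t m)" by blast
    have "card S1 \<le> (card H - 1) * (m - 1)"
      unfolding S1_def using finH one
      by (intro order_trans[OF card_image_le]) (auto simp: card_cartesian_product card_Diff_singleton)
    moreover have "card S2 \<le> m - 1"
      unfolding S2_def by (intro order_trans[OF card_image_le]) auto
    ultimately have "card (S1 \<union> S2) \<le> (card H - 1) * (m - 1) + (m - 1)"
      using card_Un_le[of S1 S2] by linarith
    also have "\<dots> = card H * (m - 1)"
      using card by (cases "card H") auto
    finally show "card (S1 \<union> S2) \<le> card H * (m - 1)" .
  next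
    fix M h j assume "subspace M" "relation_vector ` (S1 \<union> S2) \<subseteq> M" "h \<in> H" "j < m"
    then show "f h + f (t [^] j) - f (h \<otimes> t [^] j) \<in> M" by (rule coset)
  next
    fix M assume M: "subspace M" and S: "relation_vector ` (S1 \<union> S2) \<subseteq> M" and add: "additive_mod M H"
    show "additive_mod M (adjoin H t m)"
    proof (rule additive_mod_adjoin[OF H t tm M add coset[OF M S]])
      fix j assume j: "0 < j" "j < m"
      then have "(k \<otimes> t, t [^] j, k, t [^] Suc j) \<in> S2" by (auto simp: S2_def)
      then have "relation_vector (k \<otimes> t, t [^] j, k, t [^] Suc j) \<in> M" using S by blast
      moreover have "f k + f (t [^] (1::nat)) - f (k \<otimes> t [^] (1::nat)) \<in> M"
        using j k by (intro coset[OF M S]) auto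
      ultimately have "relation_vector (k \<otimes> t, t [^] j, k, t [^] Suc j) + (f k + f t - f (k \<otimes> t)) \<in> M"
        using t subspace_add[OF M] by (simp del: relation_vector.simps)
      then show "f (t [^] j) + f t - f (t [^] Suc j) \<in> M" by (simp add: algebra_simps)
    qed
  qed
qed

text \<open>Fewer than \<open>card H\<close> old relations and at most
  \<open>card H * (m - 1)\<close> new ones stay below the order \<open>card H * m\<close>. As
  \<open>t\<close> is outside \<open>H\<close>, the exponent \<open>m\<close> is at least 2 and the
  growth is strict.\<close>

lemma well_presented_adjoin:
  assumes H: "well_presented H" "3 \<le> card H" and t: "t \<in> carrier G" "t \<notin> H"
  obtains K where "well_presented K" "card H < card K"
proof -
  obtain R where R: "R \<subseteq> relations H" "card R < card H" "additive_mod (span (relation_vector ` R)) H"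
    and sub: "subgroup H G" using H by (auto simp: well_presented_def)
  obtain m :: nat where m: "0 < m" "t [^] m \<in> H" "\<forall>j. 0 < j \<longrightarrow> j < m \<longrightarrow> t [^] j \<notin> H"
    using least_power[OF sub t(1)] by blast
  let ?K = "adjoin H t m"
  obtain S where S: "S \<subseteq> relations ?K" "card S \<le> card H * (m - 1)"
    "\<forall>M. subspace M \<longrightarrow> relation_vector ` S \<subseteq> M \<longrightarrow> additive_mod M H \<longrightarrow> additive_mod M ?K"
    using adjoin_relations[OF sub H(2) t(1) m] by blast
  have K: "card ?K = card H * m" using card_adjoin[OF sub t(1) m(3)] .
  have "m \<noteq> 1" using m(2) t by auto
  then have "card H < card ?K" using m(1) H(2) K by auto
  moreover have "well_presented ?K" unfolding well_presented_def
  proof (intro conjI exI)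
    show "subgroup ?K G" using subgroup_adjoin[OF sub t(1) m(1,2)] .
    show "R \<union> S \<subseteq> relations ?K"
      using R(1) S(1) relations_mono[OF subset_adjoin[OF sub t(1) m(1)]] by blast
    have "card (R \<union> S) \<le> card R + card S" by (rule card_Un_le)
    also have "\<dots> < card H + card H * (m - 1)" using R(2) S(2) by linarith
    also have "\<dots> = card ?K" using m(1) K by (cases m) auto
    finally show "card (R \<union> S) < card ?K" .
    show "additive_mod (span (relation_vector ` (R \<union> S))) ?K"
    proof (rule S(3)[rule_format, OF subspace_span])
      show "relation_vector ` S \<subseteq> span (relation_vector ` (R \<union> S))"
        using span_superset[of "relation_vector ` (R \<union> S)"] by blast
      show "additive_mod (span (relation_vector ` (R \<union> S))) H"
        using R(3) span_mono[of "relation_vector ` R" "relation_vector ` (R \<union> S)"]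
        by (auto intro: additive_mod_mono)
    qed
  qed
  ultimately show ?thesis using that by blast
qed

text \<open>A well-presented subgroup of largest order leaves no element to adjoin.\<close>

lemma well_presented_carrier:
  assumes "well_presented H" "3 \<le> card H"
  shows "well_presented (carrier G)"
proof -
  have bound: "\<forall>K. well_presented K \<longrightarrow> card K < Suc (card (carrier G))"
    using card_mono[OF finite_carrier] subgroup.subset unfolding well_presented_def less_Suc_eq_le by blast
  obtain K where K: "well_presented K" "\<And>L. well_presented L \<Longrightarrow> card L \<le> card K"
    using ex_has_greatest_nat[of well_presented H card, OF assms(1) bound] by blast
  have "3 \<le> card K" using K(2)[OF assms(1)] assms(2) by linarith
  have "carrier G \<subseteq> K"
  proof
    fix t assume t: "t \<in> carrier G"
    show "t \<in> K"
    proof (rule ccontr)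
      assume "t \<notin> K"
      then obtain L where "well_presented L" "card K < card L"
        using well_presented_adjoin[OF K(1) \<open>3 \<le> card K\<close> t] by blast
      then show False using K(2)[of L] by simp
    qed
  qed
  moreover have "K \<subseteq> carrier G" using K(1) by (auto simp: well_presented_def dest: subgroup.subset)
  ultimately show ?thesis using K(1) by (simp add: subset_antisym)
qed


section \<open>Base cases: Klein group, cyclic groups of order at least 5, Z_3 x Z_3\<close>

lemma adjoin_0 [simp]: "adjoin H t 0 = {}"
  by (simp add: adjoin_def)

lemma adjoin_Suc: "adjoin H t (Suc m) = adjoin H t m \<union> (\<lambda>h. h \<otimes> t [^] m) ` H"
  by (auto simp: adjoin_def less_Suc_eq)

lemma additive_mod_one: "subspace M \<Longrightarrow> additive_mod M {\<one>}"
  by (simp add: additive_mod_def f_one subspace_0)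

text \<open>Over the trivial subgroup the coset condition is automatic. The case
  \<open>j = m - 1\<close> of \<open>pow\<close> closes the cycle, as \<open>t^m\<close> is the
  identity.\<close>

lemma additive_mod_cyclic:
  assumes t: "t \<in> carrier G" and tm: "t [^] m = \<one>" and M: "subspace M"
    and pow: "\<And>j. 0 < j \<Longrightarrow> j < m \<Longrightarrow> f (t [^] j) + f t - f (t [^] Suc j) \<in> M"
  shows "additive_mod M (adjoin {\<one>} t m)"
proof (rule additive_mod_adjoin[OF triv_subgroup t _ M additive_mod_one[OF M]])
  fix h and j :: nat assume "h \<in> {\<one>}"
  then show "f h + f (t [^] j) - f (h \<otimes> t [^] j) \<in> M"
    using t subspace_0[OF M] by (simp add: f_one)
qed (use tm pow in auto)

lemma pow_notin_one: "t \<in> carrier G \<Longrightarrow> \<forall>j. 0 < j \<longrightarrow> j < ord t \<longrightarrow> t [^] j \<notin> {\<one>}"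
  using pow_eq_id by (auto dest: dvd_imp_le)

text \<open>The three relations are the three splittings of the group into two pairs. Their
  combinations contain twice \<open>f x\<close> and twice \<open>f y\<close>, which replace the
  squares \<open>x x = 1\<close> and \<open>y y = 1\<close> with their repeated entries.\<close>

lemma well_presented_Klein:
  assumes x: "x \<in> carrier G" "x \<noteq> \<one>" "x \<otimes> x = \<one>"
    and y: "y \<in> carrier G" "y \<noteq> \<one>" "y \<otimes> y = \<one>" and xy: "x \<noteq> y"
  shows "\<exists>H. well_presented H \<and> 3 \<le> card H"
proof -
  define z where "z = x \<otimes> y"
  have z: "z \<noteq> \<one>" "z \<noteq> x" "z \<noteq> y" "x \<otimes> z = y" "y \<otimes> z = x" "z \<in> carrier G"
    unfolding z_def
  proof -
    let ?z = "x \<otimes> y"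
    show "?z \<noteq> \<one>" using x y xy inv_equality by metis
    show "x \<otimes> ?z = y" "y \<otimes> ?z = x" using x y by (simp_all add: m_assoc[symmetric], simp add: m_ac)
  qed (use x y in auto)
  define H0 where "H0 = adjoin {\<one>} x 2"
  define H where "H = adjoin H0 y 2"
  have H0: "H0 = {\<one>, x}" using x by (auto simp: H0_def adjoin_Suc numeral_2_eq_2)
  have H: "H = {\<one>, x, y, z}" using x y by (auto simp: H_def H0 z_def adjoin_Suc numeral_2_eq_2)
  have sub0: "subgroup H0 G"
    unfolding H0_def using x by (intro subgroup_adjoin triv_subgroup) (auto simp: numeral_2_eq_2)
  have sub: "subgroup H G"
    unfolding H_def using y sub0 by (intro subgroup_adjoin) (auto simp: numeral_2_eq_2 H0)
  have card: "card H = 4" using H z x y xy by auto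
  let ?R = "{(x, y, z, \<one>), (x, \<one>, y, z), (x, z, y, \<one>)}"
  let ?M = "span (relation_vector ` ?R)"
  have "?R \<subseteq> relations H"
    using x y xy z z(1-3)[symmetric] by (simp add: relations_def H flip: z_def)
  moreover have "card ?R < card H"
    unfolding card by (rule le_less_trans[of _ "length [(x, y, z, \<one>), (x, \<one>, y, z), (x, z, y, \<one>)]"])
      (use card_length[of "[(x, y, z, \<one>), (x, \<one>, y, z), (x, z, y, \<one>)]"] in simp_all)
  moreover have "additive_mod ?M H"
  proof -
    have M: "subspace ?M" by (rule subspace_span)
    have r: "f x + f y - f z \<in> ?M" "f x - f y - f z \<in> ?M" "f x + f z - f y \<in> ?M"
      using span_superset[of "relation_vector ` ?R"] by (auto simp: f_one)
    have add0: "additive_mod ?M H0" unfolding H0_def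
    proof (rule additive_mod_cyclic[OF x(1) _ M])
      fix j :: nat assume "0 < j" "j < 2"
      then have "j = 1" by linarith
      then show "f (x [^] j) + f x - f (x [^] Suc j) \<in> ?M"
        using subspace_add[OF M r(1) r(3)] x by (simp add: f_one algebra_simps)
    qed (use x in \<open>simp add: numeral_2_eq_2\<close>)
    show ?thesis unfolding H_def
    proof (rule additive_mod_adjoin[OF sub0 y(1) _ M add0])
      fix h and j :: nat assume h: "h \<in> H0" and "0 < j" "j < 2"
      then have "j = 1" by linarith
      then show "f h + f (y [^] j) - f (h \<otimes> y [^] j) \<in> ?M"
        using h r(1) y subspace_0[OF M] by (auto simp: H0 f_one z_def)
    next
      fix j :: nat assume "0 < j" "j < 2"
      then have "j = 1" by linarith
      then show "f (y [^] j) + f y - f (y [^] Suc j) \<in> ?M"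
        using subspace_diff[OF M r(1) r(2)] y by (simp add: f_one algebra_simps)
    qed (use y in \<open>simp add: numeral_2_eq_2 H0\<close>)
  qed
  ultimately have "well_presented H" using sub unfolding well_presented_def by blast
  then show ?thesis using card by auto
qed

text \<open>Among the relations \<open>t^j t = t^(j + 1)\<close> only \<open>j = 1\<close> and
  \<open>j = m - 1\<close> have repeated entries. The relations \<open>?a\<close> and
  \<open>?b\<close> replace these two, so the total is at most \<open>m - 1\<close>. Order at least
  5 keeps \<open>t^(m - 1)\<close> and \<open>t^3\<close> apart in \<open>?b\<close>, which fails in
  Z_4.\<close>

lemma well_presented_cyclic:
  assumes t: "t \<in> carrier G" and m: "5 \<le> ord t"
  shows "\<exists>H. well_presented H \<and> 3 \<le> card H"
proof -
  define m where "m = ord t"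
  define H where "H = adjoin {\<one>} t m"
  have m5: "5 \<le> m" using m by (simp add: m_def)
  have tm: "t [^] m = \<one>" using t by (simp add: m_def)
  have sub: "subgroup H G"
    unfolding H_def using t m5 tm by (intro subgroup_adjoin triv_subgroup) auto
  have card: "card H = m"
    using card_adjoin[OF triv_subgroup t pow_notin_one[OF t]] by (simp add: H_def m_def)
  have inj: "t [^] i = t [^] j \<longleftrightarrow> i = j" if "i < m" "j < m" for i j :: nat
    using inj_onD[OF ord_inj[OF t], of i j] that by (auto simp: m_def)
  have inj1: "t [^] i = t \<longleftrightarrow> i = 1" "t [^] i = \<one> \<longleftrightarrow> i = 0" if "i < m" for i :: nat
    using inj[OF that, of 1] inj[OF that, of 0] t m5 by auto
  have mem: "t [^] j \<in> H" if "j < m" for j :: nat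
    using adjoin_memI[of \<one> "{\<one>}" j m t] that t by (simp add: H_def)
  have mem1: "\<one> \<in> H" "t \<in> H" using mem[of 0] mem[of 1] m5 t by auto
  let ?r = "\<lambda>j. (t [^] Suc j, \<one>, t [^] j, t)"
  let ?a = "(t [^] (m - 1), t [^] (2::nat), t, \<one>)"
  let ?b = "(t [^] (m - 1), t [^] (3::nat), t [^] (2::nat), \<one>)"
  let ?R = "insert ?a (insert ?b (?r ` {2..m - 2}))"
  let ?M = "span (relation_vector ` ?R)"
  have "?r j \<in> relations H" if "2 \<le> j" "j \<le> m - 2" for j
  proof -
    have *: "j < m" "Suc j < m" using that m5 by auto
    then have "distinct [t [^] Suc j, \<one>, t [^] j, t]"
      using inj[OF *(2,1)] inj1[OF *(1)] inj1[OF *(2)] inj1[of 0] inj1[of 1] that m5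
      by (auto simp del: nat_pow_Suc simp: eq_commute[of \<one>])
    then show ?thesis using mem[OF *(1)] mem[OF *(2)] mem1 t by (simp add: relations_def)
  qed
  moreover have "?a \<in> relations H" "?b \<in> relations H"
  proof -
    \<comment> \<open>The power \<open>t^(m - 1)\<close> is the inverse of \<open>t\<close>.\<close>
    have w: "t [^] (m - 1) \<otimes> t [^] Suc k = t [^] k" for k
    proof -
      have "t [^] (m - 1) \<otimes> t [^] Suc k = t [^] (m + k)"
        using t m5 nat_pow_mult[of t "m - 1" "Suc k"] by (simp del: nat_pow_Suc)
      then show ?thesis using t tm by (simp add: nat_pow_mult[symmetric])
    qed
    have *: "m - 1 < m" "2 < m" "3 < m" "1 < m" "0 < m" using m5 by auto
    have mul: "t [^] (m - 1) \<otimes> t [^] (2::nat) = t \<otimes> \<one>" "t [^] (m - 1) \<otimes> t [^] (3::nat) = t [^] (2::nat) \<otimes> \<one>"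
      using w[of 1] w[of 2] t by (simp_all add: numeral_2_eq_2 numeral_3_eq_3 del: nat_pow_Suc)
    have "distinct [t [^] (m - 1), t [^] (2::nat), t [^] (1::nat), t [^] (0::nat)]"
         "distinct [t [^] (m - 1), t [^] (3::nat), t [^] (2::nat), t [^] (0::nat)]"
      using * m5 by (simp_all only: distinct.simps list.set insert_iff empty_iff inj) auto
    then have "distinct [t [^] (m - 1), t [^] (2::nat), t, \<one>]"
         "distinct [t [^] (m - 1), t [^] (3::nat), t [^] (2::nat), \<one>]"
      using t by auto
    then show "?a \<in> relations H" "?b \<in> relations H"
      using mul mem[OF *(1)] mem[OF *(2)] mem[OF *(3)] mem1 by (simp_all add: relations_def)
  qed
  ultimately have R: "?R \<subseteq> relations H" by auto
  have "card (?r ` {2..m - 2}) \<le> m - 3"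
    using m5 by (intro order_trans[OF card_image_le]) auto
  then have "card ?R \<le> Suc (Suc (m - 3))"
    using card_insert_le_m1 by (simp add: card_insert_if)
  then have cardR: "card ?R < card H" using m5 card by simp
  have M: "subspace ?M" by (rule subspace_span)
  have r: "f (t [^] Suc j) - f (t [^] j) - f t \<in> ?M" if "2 \<le> j" "j \<le> m - 2" for j
  proof -
    have "relation_vector (?r j) \<in> ?M" using that by (intro span_base imageI) auto
    then show ?thesis by (simp add: f_one)
  qed
  have a: "f (t [^] (m - 1)) + f (t [^] (2::nat)) - f t \<in> ?M"
  proof -
    have "relation_vector ?a \<in> ?M" by (intro span_base imageI) auto
    then show ?thesis by (simp add: f_one)
  qed
  have b: "f (t [^] (m - 1)) + f (t [^] (3::nat)) - f (t [^] (2::nat)) \<in> ?M"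
  proof -
    have "relation_vector ?b \<in> ?M" by (intro span_base imageI) auto
    then show ?thesis by (simp add: f_one)
  qed
  have r2: "f (t [^] (3::nat)) - f (t [^] (2::nat)) - f t \<in> ?M"
    using r[of 2] m5 by (simp add: eval_nat_numeral)
  \<comment> \<open>The relation \<open>t t = t^2 1\<close> has a repeated entry, so it has to be obtained indirectly.\<close>
  have d: "f (t [^] (2::nat)) - f t - f t \<in> ?M"
    using subspace_add[OF M subspace_diff[OF M a b] r2] by (simp add: algebra_simps)
  have "additive_mod ?M H" unfolding H_def
  proof (rule additive_mod_cyclic[OF t tm M])
    fix j assume j: "0 < j" "j < m"
    consider "j = 1" | "2 \<le> j \<and> j \<le> m - 2" | "j = m - 1" using j by linarith
    then show "f (t [^] j) + f t - f (t [^] Suc j) \<in> ?M"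
    proof cases
      case 1
      then have "t [^] j = t" "t [^] Suc j = t [^] (2::nat)" using t by (auto simp: numeral_2_eq_2)
      then show ?thesis using subspace_neg[OF M d] by (simp add: algebra_simps)
    next
      case 2
      then show ?thesis using subspace_neg[OF M r[of j]] by (simp add: algebra_simps del: nat_pow_Suc)
    next
      \<comment> \<open>The difference of \<open>a\<close> and \<open>d\<close> is
        \<open>f (t^(m - 1)) + f t\<close>, the relation that closes the cycle.\<close>
      case 3
      then have "Suc j = m" using m5 by simp
      then have "t [^] Suc j = \<one>" using tm by simp
      then show ?thesis using subspace_diff[OF M a d] 3 by (simp add: f_one algebra_simps del: nat_pow_Suc)
    qed
  qed
  then have "well_presented H" using R cardR sub unfolding well_presented_def by blast
  then show ?thesis using card m5 by auto
qed

text \<open>A group of order 3 has no four distinct elements, so \<open>H0\<close> cannot be treated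
  first. Its relations \<open>x x = w\<close> and \<open>w x = 1\<close> are multiplied by
  \<open>y\<close> to separate their entries, giving \<open>?a\<close> and \<open>?b\<close>; the
  coset relations from adjoining \<open>y\<close> then remove \<open>y\<close> again. The total is
  at most 6 + 2 = 8.\<close>

lemma well_presented_elementary_9:
  assumes x: "x \<in> carrier G" "ord x = 3" and y: "y \<in> carrier G" "ord y = 3"
    and xy: "y \<notin> {\<one>, x, x \<otimes> x}"
  shows "\<exists>H. well_presented H \<and> 3 \<le> card H"
proof -
  let ?w = "x \<otimes> x"
  define H0 where "H0 = adjoin {\<one>} x 3"
  define H where "H = adjoin H0 y 3"
  have x3: "x [^] (3::nat) = \<one>" and y3: "y [^] (3::nat) = \<one>"
    using pow_ord_eq_1[OF x(1)] pow_ord_eq_1[OF y(1)] x(2) y(2) by auto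
  have xxx: "?w \<otimes> x = \<one>" using x3 x by (simp add: numeral_3_eq_3)
  have H0: "H0 = {\<one>, x, ?w}"
    using x by (auto simp: H0_def adjoin_Suc numeral_3_eq_3)
  have card0: "card H0 = 3"
    using card_adjoin[OF triv_subgroup x(1) pow_notin_one[OF x(1)]] x(2) by (simp add: H0_def)
  then have neq: "x \<noteq> \<one>" "?w \<noteq> \<one>" "?w \<noteq> x" by (auto simp: H0 card_insert_if split: if_splits)
  have sub0: "subgroup H0 G"
    unfolding H0_def using x x3 by (intro subgroup_adjoin triv_subgroup) auto
  have y0: "y \<notin> H0" using xy H0 by blast
  have yy0: "y \<otimes> y \<notin> H0"
  proof
    assume "y \<otimes> y \<in> H0"
    then have "(y \<otimes> y) \<otimes> (y \<otimes> y) \<in> H0" using sub0 by (simp add: subgroup.m_closed)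
    moreover have "(y \<otimes> y) \<otimes> (y \<otimes> y) = y [^] (3::nat) \<otimes> y" using y by (simp add: numeral_3_eq_3 m_ac)
    ultimately show False using y3 y y0 by simp
  qed
  have least: "\<forall>j::nat. 0 < j \<longrightarrow> j < 3 \<longrightarrow> y [^] j \<notin> H0"
  proof (intro allI impI)
    fix j :: nat assume "0 < j" "j < 3"
    then have "j = 1 \<or> j = Suc 1" by linarith
    then show "y [^] j \<notin> H0" using y0 yy0 y by auto
  qed
  have y3': "y [^] (3::nat) \<in> H0" using y3 H0 by simp
  have sub: "subgroup H G"
    unfolding H_def using y y3' sub0 by (intro subgroup_adjoin) auto
  have card: "card H = 9" using card_adjoin[OF sub0 y(1) least] card0 by (simp add: H_def)
  obtain S where S: "S \<subseteq> relations H" "card S \<le> card H0 * (3 - 1)"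
    "\<forall>M. subspace M \<longrightarrow> relation_vector ` S \<subseteq> M \<longrightarrow>
      (\<forall>h\<in>H0. \<forall>j<3::nat. f h + f (y [^] j) - f (h \<otimes> y [^] j) \<in> M)"
    "\<forall>M. subspace M \<longrightarrow> relation_vector ` S \<subseteq> M \<longrightarrow> additive_mod M H0 \<longrightarrow> additive_mod M H"
    using adjoin_relations[OF sub0 _ y(1) _ y3' least] card0 unfolding H_def by auto
  let ?a = "(x \<otimes> y, x, y, ?w)"
  let ?b = "(?w \<otimes> y, x, y, \<one>)"
  let ?R = "insert ?a (insert ?b S)"
  let ?M = "span (relation_vector ` ?R)"
  have "?a \<in> relations H" "?b \<in> relations H"
  proof -
    have n: "x \<otimes> y \<notin> H0" "?w \<otimes> y \<notin> H0"
      using mult_notin_subgroup[OF sub0 _ y(1) y0] H0 by auto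
    have "H0 \<subseteq> H" "y \<in> H" unfolding H_def
      using subset_adjoin[OF sub0 y(1)] mem_adjoin[OF sub0 y(1) _ y3'] by auto
    moreover from this have "x \<otimes> y \<in> H" "?w \<otimes> y \<in> H"
      using H0 sub by (auto simp: subgroup.m_closed)
    moreover have "?w \<otimes> y \<otimes> x = y"
    proof -
      have "?w \<otimes> y \<otimes> x = (?w \<otimes> x) \<otimes> y" using x y by (simp add: m_ac)
      then show ?thesis using xxx y by simp
    qed
    moreover have "x \<otimes> y \<otimes> x = y \<otimes> ?w" using x y by (simp add: m_ac)
    ultimately show "?a \<in> relations H" "?b \<in> relations H"
      using n y0 neq x y H0 by (auto simp: relations_def)
  qed
  then have R: "?R \<subseteq> relations H" using S(1) by auto
  have "finite S" using S(1) finite_relations[OF subgroup.subset[OF sub]] finite_subset by blast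
  then have "card ?R \<le> Suc (Suc (card S))" by (simp add: card_insert_if)
  then have cardR: "card ?R < card H" using S(2) card card0 by simp
  have M: "subspace ?M" by (rule subspace_span)
  have SM: "relation_vector ` S \<subseteq> ?M" using span_superset[of "relation_vector ` ?R"] by auto
  have co: "f h + f y - f (h \<otimes> y) \<in> ?M" if "h \<in> H0" for h
    using S(3)[rule_format, OF M SM that, of 1] y by simp
  have ab: "f (x \<otimes> y) + f x - f y - f ?w \<in> ?M" "f (?w \<otimes> y) + f x - f y \<in> ?M"
    using span_superset[of "relation_vector ` ?R"] by (auto simp: f_one)
  have "additive_mod ?M H0" unfolding H0_def
  proof (rule additive_mod_cyclic[OF x(1) x3 M])
    fix j :: nat assume "0 < j" "j < 3"
    then have "j = 1 \<or> j = Suc 1" by linarith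
    then show "f (x [^] j) + f x - f (x [^] Suc j) \<in> ?M"
    proof
      assume "j = 1"
      then show ?thesis using subspace_add[OF M co[of x] ab(1)] x H0 by (simp add: algebra_simps)
    next
      assume "j = Suc 1"
      then show ?thesis using subspace_add[OF M co[of ?w] ab(2)] x H0 xxx by (simp add: f_one algebra_simps)
    qed
  qed
  then have "additive_mod ?M H" using S(4) M SM by blast
  then have "well_presented H" using R cardR sub unfolding well_presented_def by blast
  then show ?thesis using card by auto
qed


section \<open>Finding a base case inside every group of order at least 4 other than Z_4\<close>

lemma ord_cases_le_4:
  assumes "x \<in> carrier G" "ord x < 5"
  obtains "ord x = 3" | "x [^] (4::nat) = \<one>"
proof -
  have "1 \<le> ord x" using ord_ge_1[OF finite_carrier assms(1)] .
  then have "ord x = 1 \<or> ord x = 2 \<or> ord x = 3 \<or> ord x = 4" using assms(2) by linarith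
  then have "ord x = 3 \<or> ord x dvd 4" by auto
  then show ?thesis using that pow_eq_id[OF assms(1)] by blast
qed

text \<open>An element \<open>s\<close> of order 3 is impossible, since \<open>s t\<close> would
  have order neither 3 nor a divisor of 4. So \<open>s s\<close> squares to the identity for every
  \<open>s\<close>, and is the identity or the only involution \<open>t t\<close>. In the latter
  case \<open>s t\<close> also squares to the identity, and each possibility makes \<open>s\<close>
  a power of \<open>t\<close>.\<close>

lemma cyclic_of_ord_4:
  assumes small: "\<And>x. x \<in> carrier G \<Longrightarrow> ord x < 5"
    and invol: "\<And>x y. \<lbrakk>x \<in> carrier G; y \<in> carrier G; x \<noteq> \<one>; y \<noteq> \<one>; x \<otimes> x = \<one>; y \<otimes> y = \<one>\<rbrakk> \<Longrightarrow> x = y"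
    and t: "t \<in> carrier G" "ord t = 4"
  shows "G \<cong> integer_mod_group 4"
proof -
  have t4: "t [^] (4::nat) = \<one>" using pow_ord_eq_1[OF t(1)] t(2) by simp
  have tn: "t [^] (2::nat) \<noteq> \<one>" "t [^] (3::nat) \<noteq> \<one>" "t \<noteq> \<one>"
    using pow_eq_id[OF t(1), of 2] pow_eq_id[OF t(1), of 3] t by (auto dest: dvd_imp_le)
  have two: "t [^] (2::nat) = t \<otimes> t" using t by (simp add: numeral_2_eq_2)
  have three: "t [^] (3::nat) = t \<otimes> t \<otimes> t" using t by (simp add: numeral_3_eq_3)
  have t4': "t \<otimes> t \<otimes> (t \<otimes> t) = \<one>" "t \<otimes> t \<otimes> t \<otimes> t = \<one>"
    using t4 t by (simp_all add: eval_nat_numeral m_assoc)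
  have "s \<in> (\<lambda>j::nat. t [^] j) ` {..<4}" if s: "s \<in> carrier G" for s
  proof -
    have "ord s \<noteq> 3"
    proof
      assume os: "ord s = 3"
      then have s3: "s [^] (3::nat) = \<one>" using pow_ord_eq_1[OF s] by simp
      have st: "s \<otimes> t \<in> carrier G" using s t by simp
      from st small[OF st] show False
      proof (cases rule: ord_cases_le_4)
        case 1
        then have "(s \<otimes> t) [^] (3::nat) = \<one>" using pow_ord_eq_1[OF st] by simp
        then have "t [^] (3::nat) = \<one>" using s3 s t by (simp add: nat_pow_distrib)
        then show False using tn by simp
      next
        case 2
        then have "s [^] (4::nat) = \<one>" using t4 s t by (simp add: nat_pow_distrib)
        then show False using pow_eq_id[OF s, of 4] os by auto
      qed
    qed
    then have s4: "s [^] (4::nat) = \<one>" using ord_cases_le_4[OF s small[OF s]] by blast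
    have s4': "s \<otimes> s \<otimes> (s \<otimes> s) = \<one>" using s4 s by (simp add: eval_nat_numeral m_assoc)
    have dbl: "x = \<one> \<or> x = t \<otimes> t" if "x \<in> carrier G" "x \<otimes> x = \<one>" for x
      using invol[OF that(1) _ _ _ that(2), of "t \<otimes> t"] t t4' tn two by auto
    have "s = \<one> \<or> s = t \<or> s = t \<otimes> t \<or> s = t \<otimes> t \<otimes> t"
      using dbl[of "s \<otimes> s"]
    proof
      assume "s \<otimes> s = \<one>"
      then show ?thesis using dbl[OF s] by auto
    next
      assume e: "s \<otimes> s = t \<otimes> t"
      have "(s \<otimes> t) \<otimes> (s \<otimes> t) = (s \<otimes> s) \<otimes> (t \<otimes> t)" using s t by (simp add: m_ac)
      then have "(s \<otimes> t) \<otimes> (s \<otimes> t) = \<one>" using e t4' by simp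
      then have "s \<otimes> t = \<one> \<or> s \<otimes> t = t \<otimes> t" using dbl[of "s \<otimes> t"] s t by simp
      then have "s \<otimes> t = (t \<otimes> t \<otimes> t) \<otimes> t \<or> s \<otimes> t = t \<otimes> t" using t4' by simp
      then show ?thesis using s t(1) by (auto simp del: m_assoc)
    qed (use s s4' in auto)
    then have "s = t [^] (0::nat) \<or> s = t [^] (1::nat) \<or> s = t [^] (2::nat) \<or> s = t [^] (3::nat)"
      using two three t by auto
    moreover have "t [^] j \<in> (\<lambda>j::nat. t [^] j) ` {..<4}" if "j < 4" for j :: nat
      using that by blast
    from this[of 0] this[of 1] this[of 2] this[of 3]
    have "{t [^] (0::nat), t [^] (1::nat), t [^] (2::nat), t [^] (3::nat)} \<subseteq> (\<lambda>j::nat. t [^] j) ` {..<4}"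
      by simp
    ultimately show ?thesis by blast
  qed
  then have "carrier G = (\<lambda>j::nat. t [^] j) ` {..<4}" using t by auto
  then show ?thesis using iso_integer_mod_group[OF t(1) _ t(2)] by simp
qed

text \<open>Without a base case all element orders are at most 3 and there is at most one
  involution. An involution times an element of order 3 would have order 6, so every nontrivial
  element has order 3; a fourth element then lies outside the subgroup generated by
  \<open>x\<close>.\<close>

lemma ex_well_presented:
  assumes card: "4 \<le> card (carrier G)" and not4: "\<not> G \<cong> integer_mod_group 4"
  shows "\<exists>H. well_presented H \<and> 3 \<le> card H"
proof (rule ccontr)
  assume no: "\<not> ?thesis"
  have small: "ord x < 5" if "x \<in> carrier G" for x
    using well_presented_cyclic[OF that] no by (meson not_le_imp_less)
  have invol: "x = y" if "x \<in> carrier G" "y \<in> carrier G" "x \<noteq> \<one>" "y \<noteq> \<one>" "x \<otimes> x = \<one>" "y \<otimes> y = \<one>" for x y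
    using well_presented_Klein[of x y] that no by blast
  have no4: "ord x \<noteq> 4" if "x \<in> carrier G" for x
    using cyclic_of_ord_4[OF small invol that] not4 by blast
  have ords: "ord x = 3 \<or> x \<otimes> x = \<one>" if x: "x \<in> carrier G" for x
  proof -
    have "1 \<le> ord x" using ord_ge_1[OF finite_carrier x] .
    then have "ord x = 1 \<or> ord x = 2 \<or> ord x = 3" using small[OF x] no4[OF x] by linarith
    then have "ord x = 3 \<or> x [^] (2::nat) = \<one>" using pow_eq_id[OF x, of 2] by auto
    then show ?thesis using x by (simp add: numeral_2_eq_2)
  qed
  have new: "\<exists>s \<in> carrier G. s \<notin> {a, b, c}" for a b c
  proof (rule ccontr)
    assume "\<not> ?thesis"
    then have "card (carrier G) \<le> card {a, b, c}" by (intro card_mono) auto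
    also have "\<dots> \<le> 3" using card_length[of "[a, b, c]"] by simp
    finally show False using card by simp
  qed
  have no2: "x = \<one>" if x: "x \<in> carrier G" "x \<otimes> x = \<one>" for x
  proof (rule ccontr)
    assume x1: "x \<noteq> \<one>"
    \<comment> \<open>As \<open>x\<close> is the only involution, this element has order 3.\<close>
    obtain s where s: "s \<in> carrier G" "s \<noteq> \<one>" "s \<noteq> x" using new[of \<one> x x] by auto
    then have "ord s = 3" using ords[OF s(1)] invol[OF x(1) s(1)] x x1 by blast
    then have s3: "s [^] (3::nat) = \<one>" and s2: "s \<otimes> s \<noteq> \<one>"
      using pow_ord_eq_1[OF s(1)] pow_eq_id[OF s(1), of 2] s(1) by (auto simp: numeral_2_eq_2 dest: dvd_imp_le)
    have x3: "x [^] (3::nat) = x" using x by (simp add: numeral_3_eq_3)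
    have xs: "x \<otimes> s \<in> carrier G" using x s by simp
    from ords[OF xs] show False
    proof
      assume "ord (x \<otimes> s) = 3"
      then have "(x \<otimes> s) [^] (3::nat) = \<one>" using pow_ord_eq_1[OF xs] by simp
      then show False using x s x3 s3 x1 by (simp add: nat_pow_distrib)
    next
      assume "x \<otimes> s \<otimes> (x \<otimes> s) = \<one>"
      moreover have "x \<otimes> s \<otimes> (x \<otimes> s) = (x \<otimes> x) \<otimes> (s \<otimes> s)" using x s by (simp add: m_ac)
      ultimately show False using x s s2 by simp
    qed
  qed
  obtain x where x: "x \<in> carrier G" "x \<noteq> \<one>" using new[of \<one> \<one> \<one>] by auto
  obtain y where y: "y \<in> carrier G" "y \<notin> {\<one>, x, x \<otimes> x}" using new[of \<one> x "x \<otimes> x"] by auto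
  have "ord x = 3" "ord y = 3"
    using ords[OF x(1)] no2[OF x(1)] x(2) ords[OF y(1)] no2[OF y(1)] y(2) by blast+
  then show False using well_presented_elementary_9[OF x(1) _ y(1) _ y(2)] no by blast
qed

lemma relations_carrier:
  assumes "4 \<le> card (carrier G)" and "\<not> G \<cong> integer_mod_group 4"
  shows "\<exists>R \<subseteq> relations (carrier G). card R < order G \<and>
           additive_mod (span (relation_vector ` R)) (carrier G)"
  using ex_well_presented[OF assms] well_presented_carrier by (auto simp: well_presented_def order_def)


section \<open>Extending additivity to integer powers and finite products\<close>

lemma additive_mod_int_pow:
  assumes M: "subspace M" and add: "additive_mod M (carrier G)" and a: "a \<in> carrier G"
  shows "z *s f a - f (a [^] (z::int)) \<in> M"
proof -
  have nat: "int k *s f a - f (a [^] k) \<in> M" for k :: nat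
  proof (induction k)
    case 0
    then show ?case by (simp add: f_one subspace_0[OF M])
  next
    case (Suc k)
    have "f (a [^] k) + f a - f (a [^] Suc k) \<in> M" using add a by (simp add: additive_mod_def)
    from subspace_add[OF M Suc this] show ?case by (simp add: scale_left_distrib algebra_simps)
  qed
  show ?thesis
  proof (cases z rule: int_cases2)
    case (nonneg k)
    then show ?thesis using nat[of k] by (simp add: int_pow_int)
  next
    case (nonpos k)
    have "f (a [^] k) + f (inv (a [^] k)) - f (a [^] k \<otimes> inv (a [^] k)) \<in> M"
      using add a unfolding additive_mod_def by blast
    then have "f (a [^] k) + f (inv (a [^] k)) \<in> M" using a by (simp add: f_one)
    from subspace_neg[OF M subspace_add[OF M nat[of k] this]] show ?thesis
      using nonpos a by (simp add: int_pow_neg_int algebra_simps)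
  qed
qed

text \<open>When the product is the identity its label is 0, so the linear combination itself lies
  in \<open>M\<close>; lattice vectors are captured this way.\<close>

lemma additive_mod_finprod:
  assumes M: "subspace M" and add: "additive_mod M (carrier G)"
    and "finite I" "\<And>i. i \<in> I \<Longrightarrow> a i \<in> carrier G"
  shows "(\<Sum>i\<in>I. x i *s f (a i)) - f (\<Otimes>i\<in>I. a i [^] (x i :: int)) \<in> M"
  using assms(3,4)
proof (induction I rule: finite_induct)
  case empty
  then show ?case by (simp add: f_one subspace_0[OF M])
next
  case (insert j I)
  let ?p = "\<Otimes>i\<in>I. a i [^] x i"
  have p: "?p \<in> carrier G" using insert.prems by (intro finprod_closed) auto
  have aj: "a j \<in> carrier G" using insert.prems by simp
  have e: "(\<Otimes>i\<in>insert j I. a i [^] x i) = a j [^] x j \<otimes> ?p"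
    using insert by (intro finprod_insert) auto
  have 1: "f (a j [^] x j) + f ?p - f (a j [^] x j \<otimes> ?p) \<in> M"
    using add p aj by (simp add: additive_mod_def)
  have 2: "(\<Sum>i\<in>I. x i *s f (a i)) - f ?p \<in> M" using insert by simp
  note subspace_add[OF M subspace_add[OF M additive_mod_int_pow[OF M add aj, of "x j"] 2] 1]
  then show ?case using insert.hyps unfolding e by (simp add: algebra_simps)
qed

end

section \<open>Integer vectors of small norm\<close>

lemma sum_fun_apply: "(\<Sum>k\<in>A. F k) i = (\<Sum>k\<in>A. F k i)"
  by (induction A rule: infinite_finite_induct) auto

lemma module_int_fun: "Modules.module (\<lambda>(c::int) X i. c * X i :: int)"
  by standard (auto simp: fun_eq_iff algebra_simps)

lemma vector_space_real_fun: "vector_space (\<lambda>(c::real) X i. c * X i :: real)"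
  by standard (auto simp: fun_eq_iff algebra_simps)

lemma euclidean_norm_sqrt: "euclidean_norm m X = sqrt (of_int (\<Sum>i=1..m. (X i)\<^sup>2))"
  by (simp add: euclidean_norm_def L2_set_def)

text \<open>Minimality is reduced to integer sums of squares. Positivity of \<open>q\<close> makes
  \<open>X\<close> nonzero, so the least norm is attained at \<open>X\<close>.\<close>

lemma minimal_vectorsI:
  assumes X: "X \<in> group_lattice G n g" and q: "(\<Sum>i=1..n+1. (X i)\<^sup>2) = q" "q > 0"
    and least: "\<And>Y. Y \<in> group_lattice G n g \<Longrightarrow> Y \<noteq> (\<lambda>_. 0) \<Longrightarrow> q \<le> (\<Sum>i=1..n+1. (Y i)\<^sup>2)"
  shows "X \<in> minimal_vectors G n g"
proof -
  have "X \<noteq> (\<lambda>_. 0)" using q by auto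
  then have "min_distance G n g = euclidean_norm (n + 1) X"
    unfolding min_distance_def
  proof (intro Least_equality)
    fix d assume "d \<in> euclidean_norm (n + 1) ` (group_lattice G n g - {\<lambda>_. 0})"
    then obtain Y where Y: "Y \<in> group_lattice G n g" "Y \<noteq> (\<lambda>_. 0)" and d: "d = euclidean_norm (n + 1) Y" by blast
    then show "euclidean_norm (n + 1) X \<le> d"
      using least[OF Y] q(1) unfolding d euclidean_norm_sqrt by (simp only: real_sqrt_le_iff of_int_le_iff)
  qed (use X in auto)
  then show ?thesis using X by (simp add: minimal_vectors_def)
qed

lemma sum_zero_signs:
  fixes X :: "'i \<Rightarrow> int"
  assumes "finite A" "sum X A = 0" "i \<in> A" "X i \<noteq> 0"
  obtains p q where "p \<in> A" "q \<in> A" "1 \<le> X p" "X q \<le> - 1"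
proof -
  have "\<exists>p\<in>A. 1 \<le> X p"
  proof (rule ccontr)
    assume "\<not> ?thesis"
    then have "\<And>p. p \<in> A \<Longrightarrow> 0 \<le> - X p" by force
    then show False using sum_nonneg_eq_0_iff[of A "\<lambda>p. - X p"] assms by (auto simp: sum_negf)
  qed
  moreover have "\<exists>q\<in>A. X q \<le> - 1"
  proof (rule ccontr)
    assume "\<not> ?thesis"
    then have "\<And>p. p \<in> A \<Longrightarrow> 0 \<le> X p" by force
    then show False using sum_nonneg_eq_0_iff[of A X] assms by auto
  qed
  ultimately show ?thesis using that by blast
qed

lemma sum_remove_two:
  assumes "finite A" "p \<in> A" "q \<in> A" "p \<noteq> q"
  shows "sum h A = h p + h q + sum h (A - {p, q})"
proof -
  have "A - {p} - {q} = A - {p, q}" by blast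
  then show ?thesis
    using assms sum.remove[of A p h] sum.remove[of "A - {p}" q h] by (simp add: add.assoc)
qed

lemma square_ge: "x \<ge> k \<or> x \<le> - k \<Longrightarrow> k \<ge> 0 \<Longrightarrow> k\<^sup>2 \<le> (x::int)\<^sup>2"
  by (auto simp flip: abs_le_square_iff)

lemma sum_zero_square_ge_2:
  fixes X :: "'i \<Rightarrow> int"
  assumes "finite A" "sum X A = 0" "i \<in> A" "X i \<noteq> 0"
  shows "2 \<le> (\<Sum>i\<in>A. (X i)\<^sup>2)"
proof -
  obtain p q where pq: "p \<in> A" "q \<in> A" "1 \<le> X p" "X q \<le> - 1"
    using sum_zero_signs[OF assms] by blast
  then have "p \<noteq> q" by auto
  moreover have "1 \<le> (X p)\<^sup>2" "1 \<le> (X q)\<^sup>2" using pq square_ge[of 1 "X p"] square_ge[of 1 "X q"] by auto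
  moreover have "0 \<le> (\<Sum>i\<in>A - {p, q}. (X i)\<^sup>2)" by (intro sum_nonneg) auto
  ultimately show ?thesis using sum_remove_two[OF assms(1) pq(1,2), of "\<lambda>i. (X i)\<^sup>2"] by linarith
qed

text \<open>Only the root vectors e_p - e_q are this short: an entry of absolute value 2 already
  contributes 4, and a nonzero remainder, again of sum zero, would add 2 to the 2 from
  \<open>p\<close> and \<open>q\<close>.\<close>

lemma sum_zero_square_less_4:
  fixes X :: "'i \<Rightarrow> int"
  assumes A: "finite A" "sum X A = 0" "i \<in> A" "X i \<noteq> 0" and less: "(\<Sum>i\<in>A. (X i)\<^sup>2) < 4"
  obtains p q where "p \<in> A" "q \<in> A" "p \<noteq> q" "X p = 1" "X q = - 1" "\<And>i. i \<in> A - {p, q} \<Longrightarrow> X i = 0"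
proof -
  obtain p q where pq: "p \<in> A" "q \<in> A" "1 \<le> X p" "X q \<le> - 1"
    using sum_zero_signs[OF A] by blast
  then have ne: "p \<noteq> q" by auto
  have eq: "(\<Sum>i\<in>A. (X i)\<^sup>2) = (X p)\<^sup>2 + (X q)\<^sup>2 + (\<Sum>i\<in>A - {p, q}. (X i)\<^sup>2)"
    using sum_remove_two[OF A(1) pq(1,2) ne] .
  have ge: "1 \<le> (X p)\<^sup>2" "1 \<le> (X q)\<^sup>2" using pq square_ge[of 1 "X p"] square_ge[of 1 "X q"] by auto
  have rest: "0 \<le> (\<Sum>i\<in>A - {p, q}. (X i)\<^sup>2)" by (intro sum_nonneg) auto
  have "\<not> 2 \<le> X p" using square_ge[of 2 "X p"] eq ge rest less by auto
  then have p1: "X p = 1" using pq by linarith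
  have "\<not> X q \<le> - 2" using square_ge[of 2 "X q"] eq ge rest less by auto
  then have q1: "X q = - 1" using pq by linarith
  have s0: "sum X (A - {p, q}) = 0"
    using sum_remove_two[OF A(1) pq(1,2) ne, of X] A(2) p1 q1 by simp
  have "X i = 0" if "i \<in> A - {p, q}" for i
  proof (rule ccontr)
    assume "X i \<noteq> 0"
    then have "2 \<le> (\<Sum>i\<in>A - {p, q}. (X i)\<^sup>2)"
      using sum_zero_square_ge_2[OF _ s0 that] A(1) by simp
    then show False using eq ge less by linarith
  qed
  then show ?thesis using that pq ne p1 q1 by blast
qed

section \<open>The lattice of a group with enumerated elements\<close>

locale enumerated_group = comm_group G for G :: "('a, 'b) monoid_scheme" (structure) +
  fixes n :: nat and g :: "nat \<Rightarrow> 'a"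
  assumes order: "order G = n + 1"
    and bij: "bij_betw g {1..n} (carrier G - {\<one>})"
begin

text \<open>Giving the last coordinate to the identity makes the coordinates correspond to all of
  the group.\<close>

definition point :: "nat \<Rightarrow> 'a" where
  "point i = (if i = n + 1 then \<one> else g i)"

definition unit_vector :: "'a \<Rightarrow> nat \<Rightarrow> int" where
  "unit_vector a = (\<lambda>i. of_bool (i \<in> {1..n+1} \<and> point i = a))"

text \<open>This is phi. Its values at the \<open>g k\<close> form a basis of the integer vectors
  with coordinate sum zero.\<close>

definition diff_vector :: "'a \<Rightarrow> nat \<Rightarrow> int" where
  "diff_vector a = unit_vector a - unit_vector \<one>"

text \<open>The last coordinate is left out because it belongs to the identity.\<close>

definition evaluate :: "(nat \<Rightarrow> int) \<Rightarrow> 'a" where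
  "evaluate X = (\<Otimes>i\<in>{1..n}. g i [^] X i)"

lemma finite_carrier: "finite (carrier G)"
  using order card_ge_0_finite[of "carrier G"] by (simp add: order_def)

sublocale labelled_group G "\<lambda>(c::int) X i. c * X i" diff_vector
  by (intro labelled_group.intro module_int_fun labelled_group_axioms.intro finite_carrier comm_group_axioms)
    (simp add: diff_vector_def)

lemma bij_point: "bij_betw point {1..n+1} (carrier G)"
proof -
  have "bij_betw point {1..n} (carrier G - {\<one>})"
    using bij by (rule bij_betw_cong[THEN iffD1, rotated]) (auto simp: point_def)
  then have "bij_betw point ({1..n} \<union> {n + 1}) (carrier G - {\<one>} \<union> {point (n + 1)})"
    by (intro notIn_Un_bij_betw) (auto simp: point_def)
  moreover have "{1..n} \<union> {n + 1} = {1..n+1}" by auto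
  moreover have "carrier G - {\<one>} \<union> {point (n + 1)} = carrier G" by (auto simp: point_def)
  ultimately show ?thesis by simp
qed

lemma point_inj: "i \<in> {1..n+1} \<Longrightarrow> j \<in> {1..n+1} \<Longrightarrow> point i = point j \<longleftrightarrow> i = j"
  using bij_point by (auto simp: bij_betw_def inj_on_def)

lemma g_closed: "i \<in> {1..n} \<Longrightarrow> g i \<in> carrier G"
  using bij by (auto simp: bij_betw_def)

lemma ex_point: "a \<in> carrier G \<Longrightarrow> \<exists>i\<in>{1..n+1}. a = point i"
  using bij_point by (auto simp: bij_betw_def)

lemma diff_vector_point:
  assumes "k \<in> {1..n+1}"
  shows "diff_vector (point k) = (\<lambda>i. of_bool (i = k) - of_bool (i = n + 1))"
proof
  fix i
  have "point i = \<one> \<longleftrightarrow> i = n + 1" if "i \<in> {1..n+1}"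
    using point_inj[of i "n + 1"] that by (simp add: point_def)
  moreover have "point i = point k \<longleftrightarrow> i = k" if "i \<in> {1..n+1}"
    using point_inj[OF that assms] .
  ultimately show "diff_vector (point k) i = of_bool (i = k) - of_bool (i = n + 1)"
    using assms by (auto simp: diff_vector_def unit_vector_def)
qed

lemma diff_vector_g:
  "k \<in> {1..n} \<Longrightarrow> diff_vector (g k) = (\<lambda>i. of_bool (i = k) - of_bool (i = n + 1))"
  using diff_vector_point[of k] by (simp add: point_def)

lemma group_lattice_iff:
  "X \<in> group_lattice G n g \<longleftrightarrow> X \<in> int_vectors (n + 1) \<and> (\<Sum>i=1..n+1. X i) = 0 \<and> evaluate X = \<one>"
  by (auto simp: group_lattice_def evaluate_def)

lemma evaluate_closed: "evaluate X \<in> carrier G"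
  unfolding evaluate_def using g_closed by (intro finprod_closed) auto

lemma evaluate_add: "evaluate (X + Y) = evaluate X \<otimes> evaluate Y"
proof -
  have "evaluate X \<otimes> evaluate Y = (\<Otimes>i\<in>{1..n}. g i [^] X i \<otimes> g i [^] Y i)"
    unfolding evaluate_def using g_closed by (intro finprod_multf[symmetric]) auto
  also have "\<dots> = evaluate (X + Y)"
    unfolding evaluate_def using g_closed by (intro finprod_cong') (auto simp: int_pow_mult)
  finally show ?thesis by simp
qed

lemma evaluate_diff: "evaluate (X - Y) = evaluate X \<otimes> inv (evaluate Y)"
  using evaluate_add[of "X - Y" Y] evaluate_closed by (simp add: inv_solve_right)

lemma evaluate_diff_vector:
  assumes "a \<in> carrier G"
  shows "evaluate (diff_vector a) = a"
proof -
  obtain k where k: "k \<in> {1..n+1}" "a = point k" using ex_point[OF assms] by blast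
  have e: "evaluate (diff_vector a) = (\<Otimes>i\<in>{1..n}. if k = i then g i else \<one>)"
    unfolding evaluate_def k(2) diff_vector_point[OF k(1)] using g_closed
    by (intro finprod_cong') auto
  show ?thesis
  proof (cases "k = n + 1")
    case True
    then have "evaluate (diff_vector a) = (\<Otimes>i\<in>{1..n}. \<one>)"
      unfolding e by (intro finprod_cong') auto
    then show ?thesis using True k by (simp add: point_def)
  next
    case False
    then show ?thesis unfolding e using k g_closed
      by (subst finprod_singleton) (auto simp: point_def)
  qed
qed

lemma sum_diff_vector: "a \<in> carrier G \<Longrightarrow> (\<Sum>i=1..n+1. diff_vector a i) = 0"
  using ex_point[of a] by (auto simp: diff_vector_point sum_subtractf of_bool_def)

lemma diff_vector_int_vectors: "a \<in> carrier G \<Longrightarrow> diff_vector a \<in> int_vectors (n + 1)"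
  by (auto simp: int_vectors_def diff_vector_def unit_vector_def)

text \<open>The first \<open>n\<close> coordinates agree by inspection; the last one agrees because
  the coordinate sum is zero.\<close>

lemma int_vectors_decomposition:
  assumes X: "X \<in> int_vectors (n + 1)" "(\<Sum>i=1..n+1. X i) = 0"
  shows "(\<Sum>k=1..n. (\<lambda>i. X k * diff_vector (g k) i)) = X"
proof
  fix i
  have "(\<Sum>k=1..n. (\<lambda>i. X k * diff_vector (g k) i)) i
      = (\<Sum>k=1..n. X k * (of_bool (i = k) - of_bool (i = n + 1)))"
    unfolding sum_fun_apply by (intro sum.cong) (auto simp: diff_vector_g)
  also have "\<dots> = (\<Sum>k=1..n. (if i = k then X k else 0) - X k * of_bool (i = n + 1))"
    by (intro sum.cong) auto
  also have "\<dots> = (\<Sum>k=1..n. if i = k then X k else 0) - (\<Sum>k=1..n. X k) * of_bool (i = n + 1)"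
    by (simp only: sum_subtractf sum_distrib_right)
  also have "\<dots> = X i"
    using X by (auto simp: int_vectors_def)
  finally show "(\<Sum>k=1..n. (\<lambda>i. X k * diff_vector (g k) i)) i = X i" .
qed

lemma group_lattice_subset:
  assumes M: "subspace M" and add: "additive_mod M (carrier G)"
  shows "group_lattice G n g \<subseteq> M"
proof
  fix X assume "X \<in> group_lattice G n g"
  then have X: "X \<in> int_vectors (n + 1)" "(\<Sum>i=1..n+1. X i) = 0" "evaluate X = \<one>"
    by (auto simp: group_lattice_iff)
  show "X \<in> M"
    using additive_mod_finprod[OF M add, of "{1..n}" g X] g_closed X(3)
    unfolding int_vectors_decomposition[OF X(1,2)] by (simp add: evaluate_def diff_vector_def)
qed

text \<open>The entries may coincide here, as the groups of orders 2 and 3 require.\<close>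

lemma relation_vector_in_lattice:
  assumes "a \<in> carrier G" "b \<in> carrier G" "c \<in> carrier G" "d \<in> carrier G" "a \<otimes> b = c \<otimes> d"
  shows "relation_vector (a, b, c, d) \<in> group_lattice G n g"
proof -
  have "relation_vector (a, b, c, d) \<in> int_vectors (n + 1)"
    using assms(1-4)[THEN diff_vector_int_vectors] by (simp add: int_vectors_def)
  moreover have "(\<Sum>i=1..n+1. relation_vector (a, b, c, d) i) = 0"
    using assms(1-4)[THEN sum_diff_vector] by (simp add: sum.distrib sum_subtractf)
  moreover have "evaluate (relation_vector (a, b, c, d)) = a \<otimes> b \<otimes> inv c \<otimes> inv d"
    using assms(1-4)[THEN evaluate_diff_vector] by (simp add: evaluate_diff evaluate_add)
  moreover have "a \<otimes> b \<otimes> inv c \<otimes> inv d = \<one>"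
    unfolding assms(5) using assms(1-4) by (metis inv_closed inv_mult m_assoc m_closed r_inv)
  ultimately show ?thesis by (simp add: group_lattice_iff del: relation_vector.simps)
qed

text \<open>The lattice contains \<open>n\<close> vectors that are linearly independent over the
  reals, and an integral spanning set of the lattice also spans them over the reals.\<close>

lemma card_spanning_ge:
  assumes B: "finite B" and L: "group_lattice G n g \<subseteq> span B"
  shows "n \<le> card B"
proof -
  interpret real: vector_space "\<lambda>(c::real) X (i::nat). c * X i" by (rule vector_space_real_fun)
  define \<rho> :: "(nat \<Rightarrow> int) \<Rightarrow> nat \<Rightarrow> real" where "\<rho> X = (\<lambda>i. of_int (X i))" for X
  \<comment> \<open>The factor is the group order, which annihilates every element, so these
    multiples lie in the lattice.\<close>
  define w where "w k = (\<lambda>i. (int n + 1) * diff_vector (g k) i)" for k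
  have w: "w k = (\<lambda>i. (int n + 1) * (of_bool (i = k) - of_bool (i = n + 1)))" if "k \<in> {1..n}" for k
    using diff_vector_g[OF that] by (simp add: w_def)
  have wL: "w k \<in> group_lattice G n g" if k: "k \<in> {1..n}" for k
  proof -
    have "w k \<in> int_vectors (n + 1)" using k by (auto simp: w int_vectors_def)
    moreover have "(\<Sum>i=1..n+1. w k i) = 0"
      using sum_diff_vector[OF g_closed[OF k]] by (simp add: w_def flip: sum_distrib_left)
    moreover have "evaluate (w k) = \<one>"
    proof -
      have "g i [^] w k i = \<one>" if i: "i \<in> {1..n}" for i
      proof -
        have "g i [^] (n + 1) = \<one>" using pow_order_eq_1[OF g_closed[OF i]] order by simp
        then have "g i [^] (int n + 1) = \<one>" by (metis int_pow_int of_nat_1 of_nat_add)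
        then show ?thesis using g_closed[OF i] by (simp add: w_def flip: int_pow_pow)
      qed
      then show ?thesis unfolding evaluate_def by (simp cong: finprod_cong)
    qed
    ultimately show ?thesis by (simp add: group_lattice_iff)
  qed
  have span: "\<rho> X \<in> real.span (\<rho> ` B)" if "X \<in> span B" for X
    using that
  proof (induction rule: span_induct_alt)
    case base
    then show ?case using real.span_zero by (simp add: \<rho>_def zero_fun_def)
  next
    case (step c x y)
    have "\<rho> ((\<lambda>i. c * x i) + y) = (\<lambda>i. of_int c * \<rho> x i) + \<rho> y"
      by (simp add: \<rho>_def fun_eq_iff)
    then show ?case using step real.span_add real.span_scale real.span_base by (metis imageI)
  qed
  have inj: "inj_on (\<lambda>k. \<rho> (w k)) {1..n}"
  proof (rule inj_onI)
    fix j k assume jk: "j \<in> {1..n}" "k \<in> {1..n}" "\<rho> (w j) = \<rho> (w k)"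
    then have "\<rho> (w j) k = \<rho> (w k) k" by simp
    then show "j = k" using jk by (simp add: \<rho>_def w split: if_splits)
  qed
  let ?W = "(\<lambda>k. \<rho> (w k)) ` {1..n}"
  have "real.independent ?W"
  proof
    assume "real.dependent ?W"
    then obtain u v where v: "v \<in> ?W" "u v \<noteq> 0" and z: "(\<Sum>v\<in>?W. (\<lambda>i. u v * v i)) = 0"
      using real.dependent_finite[of ?W] by auto
    obtain k where k: "k \<in> {1..n}" "v = \<rho> (w k)" using v by blast
    \<comment> \<open>Among these vectors only \<open>w k\<close> is nonzero at coordinate
      \<open>k\<close>, so this coordinate isolates the coefficient \<open>u v\<close>.\<close>
    have "0 = (\<Sum>v\<in>?W. (\<lambda>i. u v * v i)) k" using z by simp
    also have "\<dots> = (\<Sum>j\<in>{1..n}. u (\<rho> (w j)) * \<rho> (w j) k)"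
      unfolding sum_fun_apply sum.reindex[OF inj] by simp
    also have "\<dots> = (\<Sum>j\<in>{1..n}. if j = k then u (\<rho> (w j)) * (real n + 1) else 0)"
      using k by (intro sum.cong) (auto simp: \<rho>_def w)
    also have "\<dots> = u v * (real n + 1)" using k by simp
    finally show False using v by simp
  qed
  moreover have "?W \<subseteq> real.span (\<rho> ` B)" using span wL L by blast
  ultimately have "card ?W \<le> card (\<rho> ` B)"
    using real.independent_span_bound[of "\<rho> ` B" ?W] B by blast
  then show ?thesis using card_image_le[OF B, of \<rho>] card_image[OF inj] by simp
qed

text \<open>At most \<open>n\<close> relations and the lower bound on spanning sets force exactly
  \<open>n\<close> distinct vectors; in particular no two relations give the same vector.\<close>

lemma minimal_basis:
  assumes R: "finite R" "card R \<le> n" "relation_vector ` R \<subseteq> minimal_vectors G n g"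
    and add: "additive_mod (span (relation_vector ` R)) (carrier G)"
  shows "\<exists>B. B \<subseteq> minimal_vectors G n g \<and> finite B \<and> card B = n \<and>
           (\<forall>X \<in> group_lattice G n g. \<exists>c :: (nat \<Rightarrow> int) \<Rightarrow> int.
              X = (\<lambda>i. \<Sum>b\<in>B. c b * b i))"
proof -
  let ?B = "relation_vector ` R"
  show ?thesis
  proof (rule exI[of _ ?B], intro conjI ballI)
  show "?B \<subseteq> minimal_vectors G n g" "finite ?B" using R by auto
  have L: "group_lattice G n g \<subseteq> span ?B"
    using group_lattice_subset[OF subspace_span add] .
  show "card ?B = n"
    using card_spanning_ge[OF _ L] card_image_le[OF R(1), of relation_vector] R by simp
  fix X assume "X \<in> group_lattice G n g"
  then have "X \<in> span ?B" using L by blast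
  then obtain c where "X = (\<Sum>b\<in>?B. (\<lambda>i. c b * b i))"
    using span_finite[of ?B] R(1) by auto
  then have "X = (\<lambda>i. \<Sum>b\<in>?B. c b * b i)" by (simp add: fun_eq_iff sum_fun_apply)
  then show "\<exists>c. X = (\<lambda>i. \<Sum>b\<in>?B. c b * b i)" by blast
  qed
qed


section \<open>Squared norm 4 and the groups of order at least 4\<close>

text \<open>Distinct entries put the four coefficients of absolute value 1 at different coordinates;
  \<open>bij_point\<close> moves the sum from coordinates to group elements.\<close>

lemma relation_vector_square:
  assumes "r \<in> relations (carrier G)"
  shows "(\<Sum>i=1..n+1. (relation_vector r i)\<^sup>2) = 4"
proof -
  obtain a b c d where r: "r = (a, b, c, d)" by (metis surj_pair)
  have abcd: "{a, b, c, d} \<subseteq> carrier G" "distinct [a, b, c, d]"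
    using assms by (auto simp: relations_def r)
  have "(\<Sum>i=1..n+1. (relation_vector r i)\<^sup>2)
      = (\<Sum>i=1..n+1. (\<lambda>x. of_bool (x = a) + of_bool (x = b) + of_bool (x = c) + of_bool (x = d)) (point i))"
    using abcd(2) by (intro sum.cong) (auto simp: r diff_vector_def unit_vector_def)
  also have "\<dots> = (\<Sum>x\<in>carrier G. of_bool (x = a) + of_bool (x = b) + of_bool (x = c) + of_bool (x = d))"
    by (rule sum.reindex_bij_betw[OF bij_point])
  also have "\<dots> = 4"
    using abcd(1) finite_carrier by (simp add: sum.distrib of_bool_def)
  finally show ?thesis .
qed

text \<open>A shorter nonzero vector would be e_p - e_q, which evaluates to the quotient of two
  different group elements and hence not to the identity.\<close>

lemma lattice_square_ge_4:
  assumes Y: "Y \<in> group_lattice G n g" "Y \<noteq> (\<lambda>_. 0)"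
  shows "4 \<le> (\<Sum>i=1..n+1. (Y i)\<^sup>2)"
proof (rule ccontr)
  assume less: "\<not> ?thesis"
  have Y': "Y \<in> int_vectors (n + 1)" "(\<Sum>i=1..n+1. Y i) = 0" "evaluate Y = \<one>"
    using Y(1) by (auto simp: group_lattice_iff)
  obtain j where j: "j \<in> {1..n+1}" "Y j \<noteq> 0"
    using Y(2) Y'(1) unfolding int_vectors_def by (metis (mono_tags, lifting) ext mem_Collect_eq)
  obtain p q where pq: "p \<in> {1..n+1}" "q \<in> {1..n+1}" "p \<noteq> q" "Y p = 1" "Y q = - 1"
    "\<And>i. i \<in> {1..n+1} - {p, q} \<Longrightarrow> Y i = 0"
    using sum_zero_square_less_4[of "{1..n+1}" Y j] Y'(2) j less by (metis finite_atLeastAtMost not_le)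
  have c: "point p \<in> carrier G" "point q \<in> carrier G"
    using bij_point pq(1,2) by (auto simp: bij_betw_def)
  have "Y i = diff_vector (point p) i - diff_vector (point q) i" for i
    unfolding diff_vector_point[OF pq(1)] diff_vector_point[OF pq(2)]
    using pq Y'(1) by (cases "i \<in> {1..n+1}") (auto simp: int_vectors_def)
  then have "Y = diff_vector (point p) - diff_vector (point q)" by (simp add: fun_eq_iff)
  then have "point p \<otimes> inv (point q) = \<one>"
    using Y'(3) c by (simp add: evaluate_diff evaluate_diff_vector)
  then have "point p = point q" using inv_equality[of "point p" "inv (point q)"] c by simp
  then show False using point_inj[OF pq(1,2)] pq(3) by simp
qed

lemma minimal_relations_large:
  assumes "3 \<le> n" "\<not> G \<cong> integer_mod_group 4"
  obtains R where "finite R" "card R \<le> n" "relation_vector ` R \<subseteq> minimal_vectors G n g"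
    "additive_mod (span (relation_vector ` R)) (carrier G)"
proof -
  obtain R where R: "R \<subseteq> relations (carrier G)" "card R < order G"
    "additive_mod (span (relation_vector ` R)) (carrier G)"
    using relations_carrier[OF _ assms(2)] assms(1) order by (auto simp: order_def)
  have "relation_vector r \<in> minimal_vectors G n g" if "r \<in> R" for r
  proof (rule minimal_vectorsI[where q = 4])
    show "relation_vector r \<in> group_lattice G n g"
    proof -
      obtain a b c d where r: "r = (a, b, c, d)" by (metis surj_pair)
      have "(a, b, c, d) \<in> relations (carrier G)" using R(1) that r by blast
      then show ?thesis unfolding r relations_def by (intro relation_vector_in_lattice) auto
    qed
    show "(\<Sum>i=1..n+1. (relation_vector r i)\<^sup>2) = 4" using relation_vector_square R(1) that by blast
  qed (use lattice_square_ge_4 in auto)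
  moreover have "finite R" using R(1) finite_relations finite_subset by blast
  moreover have "card R \<le> n" using R(2) order by simp
  ultimately show ?thesis using that R(3) by blast
qed

section \<open>Groups of order at most 3\<close>

text \<open>In prime order any nontrivial element generates. Writing the group as an
  \<open>adjoin\<close> prepares it for \<open>additive_mod_cyclic\<close>.\<close>

lemma prime_order_generator:
  assumes "prime (n + 1)"
  shows "g 1 \<in> carrier G" "ord (g 1) = n + 1" "adjoin {\<one>} (g 1) (n + 1) = carrier G" "g 1 [^] (n + 1) = \<one>"
proof -
  have "1 \<in> {1..n}" using assms prime_gt_1_nat[OF assms] by auto
  then have g: "g 1 \<in> carrier G" "g 1 \<noteq> \<one>" using bij_betwE[OF bij] by blast+
  then show "g 1 \<in> carrier G" by simp
  have "ord (g 1) dvd n + 1" using ord_dvd_group_order[OF g(1)] order by simp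
  then show o: "ord (g 1) = n + 1"
    using assms g ord_eq_1[OF g(1)] by (metis prime_nat_iff)
  then show "g 1 [^] (n + 1) = \<one>" using pow_ord_eq_1[OF g(1)] by simp
  have "card (adjoin {\<one>} (g 1) (n + 1)) = n + 1"
    using card_adjoin[OF triv_subgroup g(1) pow_notin_one[OF g(1)]] o by simp
  moreover have "adjoin {\<one>} (g 1) (n + 1) \<subseteq> carrier G" using g by (auto simp: adjoin_def)
  ultimately show "adjoin {\<one>} (g 1) (n + 1) = carrier G"
    using finite_carrier order by (simp add: card_subset_eq order_def)
qed

text \<open>The lattice consists of the multiples of (2, -2), the vector of \<open>t t = 1\<close>,
  so the minimal squared norm is 8.\<close>

lemma minimal_relations_order_2:
  assumes n: "n = 1"
  obtains R where "finite R" "card R \<le> n" "relation_vector ` R \<subseteq> minimal_vectors G n g"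
    "additive_mod (span (relation_vector ` R)) (carrier G)"
proof -
  let ?t = "g 1"
  have "prime (n + 1)" using two_is_prime_nat by (simp only: n one_add_one)
  note t = prime_order_generator[OF this, unfolded n one_add_one]
  have tt: "?t \<otimes> ?t = \<one>" using t(1,4) by (simp add: numeral_2_eq_2)
  have v: "diff_vector ?t = (\<lambda>i. of_bool (i = 1) - of_bool (i = 2))"
    by (subst diff_vector_g) (auto simp: n numeral_2_eq_2)
  have set1: "{1..n} = {1}" and set2: "{1..n+1} = {1, 2}" using n by auto
  let ?R = "{(?t, ?t, \<one>, \<one>)}"
  have r: "relation_vector (?t, ?t, \<one>, \<one>) = diff_vector ?t + diff_vector ?t" by (simp add: f_one)
  have "relation_vector (?t, ?t, \<one>, \<one>) \<in> minimal_vectors G n g"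
  proof (rule minimal_vectorsI[where q = 8])
    show "relation_vector (?t, ?t, \<one>, \<one>) \<in> group_lattice G n g"
      using t tt by (intro relation_vector_in_lattice) auto
    show "(\<Sum>i=1..n+1. (relation_vector (?t, ?t, \<one>, \<one>) i)\<^sup>2) = 8"
      unfolding r v set2 by simp
    fix Y assume Y: "Y \<in> group_lattice G n g" "Y \<noteq> (\<lambda>_. 0)"
    have Y0: "Y i = 0" if "i \<notin> {1, 2}" for i
      using Y(1) that unfolding group_lattice_iff int_vectors_def set2 by blast
    have Y': "Y 1 + Y 2 = 0" "?t [^] Y 1 = \<one>"
      using Y(1) t(1) unfolding group_lattice_iff set2 evaluate_def set1 by auto
    have "2 dvd Y 1" using Y'(2) int_pow_eq_id[OF t(1)] t(2) by simp
    moreover have "Y 1 \<noteq> 0"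
    proof
      assume "Y 1 = 0"
      then have "Y i = 0" for i
        using Y'(1) Y0[of i] by (cases "i \<in> {1, 2}") auto
      then show False using Y(2) by auto
    qed
    ultimately have "2 \<le> Y 1 \<or> Y 1 \<le> - 2" by presburger
    then have "4 \<le> (Y 1)\<^sup>2" using square_ge[of 2 "Y 1"] by simp
    moreover have "Y 2 = - Y 1" using Y'(1) by simp
    ultimately show "8 \<le> (\<Sum>i=1..n+1. (Y i)\<^sup>2)" unfolding set2 by simp
  qed simp
  moreover have "additive_mod (span (relation_vector ` ?R)) (carrier G)"
    unfolding t(3)[symmetric]
  proof (rule additive_mod_cyclic[OF t(1,4) subspace_span])
    fix j :: nat assume "0 < j" "j < 2"
    then have "j = 1" by simp
    moreover have "relation_vector (?t, ?t, \<one>, \<one>) \<in> span (relation_vector ` ?R)"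
      by (intro span_base) simp
    ultimately show "diff_vector (?t [^] j) + diff_vector ?t - diff_vector (?t [^] Suc j) \<in> span (relation_vector ` ?R)"
      using t(1) tt by (simp add: f_one)
  qed
  ultimately show ?thesis using n by (intro that[of ?R]) auto
qed

text \<open>In the coordinate order \<open>t\<close>, \<open>w\<close>, identity, the relations
  \<open>t t = w\<close> and \<open>w t = 1\<close> give (2, -1, -1) and (1, 1, -2), both of squared
  norm 6.\<close>

lemma minimal_relations_order_3:
  assumes n: "n = 2"
  obtains R where "finite R" "card R \<le> n" "relation_vector ` R \<subseteq> minimal_vectors G n g"
    "additive_mod (span (relation_vector ` R)) (carrier G)"
proof -
  let ?t = "g 1"
  let ?w = "?t \<otimes> ?t"
  have n3: "n + 1 = 3" using n by simp
  then have "prime (n + 1)" by simp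
  note t = prime_order_generator[OF this, unfolded n3]
  have ttt: "?w \<otimes> ?t = \<one>" using t(1,4) by (simp add: numeral_3_eq_3)
  have "adjoin {\<one>} ?t 3 = {\<one>, ?t, ?w}"
    using t(1) by (auto simp: adjoin_Suc numeral_3_eq_3)
  then have "carrier G = {\<one>, ?t, ?w}" using t(3) by simp
  moreover have "g 2 \<in> carrier G - {\<one>}" "g 2 \<noteq> g 1"
    using bij_betwE[OF bij] inj_onD[OF bij_betw_imp_inj_on[OF bij], of 2 1] n by auto
  ultimately have w: "g 2 = ?w" by blast
  have v: "diff_vector ?t = (\<lambda>i. of_bool (i = 1) - of_bool (i = 3))"
      "diff_vector ?w = (\<lambda>i. of_bool (i = 2) - of_bool (i = 3))"
    unfolding w[symmetric] by (subst diff_vector_g; auto simp: n)+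
  have two: "{1..n} = {1, 2}" and three: "{1..n+1} = {1, 2, 3}" using n by auto
  let ?a = "(?t, ?t, ?w, \<one>)" and ?b = "(?w, ?t, \<one>, \<one>)"
  let ?R = "{?a, ?b}"
  have r: "relation_vector ?a = diff_vector ?t + diff_vector ?t - diff_vector ?w"
    "relation_vector ?b = diff_vector ?w + diff_vector ?t" by (simp_all add: f_one)
  have least: "6 \<le> (\<Sum>i=1..n+1. (Y i)\<^sup>2)" if Y: "Y \<in> group_lattice G n g" "Y \<noteq> (\<lambda>_. 0)" for Y
  proof -
    have Y0: "Y i = 0" if "i \<notin> {1, 2, 3}" for i
      using Y(1) that unfolding group_lattice_iff int_vectors_def three by blast
    have Y': "Y 1 + (Y 2 + Y 3) = 0" "evaluate Y = \<one>"
      using Y(1) unfolding group_lattice_iff three by auto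
    have "evaluate Y = ?t [^] Y 1 \<otimes> ?w [^] Y 2"
      unfolding evaluate_def two using t(1) w by simp
    also have "?w [^] Y 2 = ?t [^] (2 * Y 2)"
      unfolding mult_2 int_pow_distrib[OF t(1) t(1)] int_pow_mult[OF t(1)] ..
    finally have "?t [^] (Y 1 + 2 * Y 2) = \<one>" using Y'(2) by (simp only: int_pow_mult[OF t(1)])
    then have 3: "3 dvd Y 1 + 2 * Y 2" using int_pow_eq_id[OF t(1)] t(2) by simp
    have nz: "Y 1 \<noteq> 0 \<or> Y 2 \<noteq> 0"
    proof (rule ccontr)
      assume "\<not> ?thesis"
      then have "Y i = 0" for i
        using Y'(1) Y0[of i] by (cases "i \<in> {1, 2, 3}") auto
      then show False using Y(2) by auto
    qed
    \<comment> \<open>In the parameters \<open>k\<close> and \<open>Y 2\<close> the squared norm is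
      6 times an integer, so it is at least 6 once it is positive.\<close>
    obtain k where k: "Y 1 = 3 * k - 2 * Y 2" using 3 by (auto elim!: dvdE simp: algebra_simps)
    have Y3: "Y 3 = Y 2 - 3 * k" using Y'(1) k by simp
    have sq: "(Y 1)\<^sup>2 + ((Y 2)\<^sup>2 + (Y 3)\<^sup>2) = 6 * ((Y 2)\<^sup>2 - 3 * (k * Y 2) + 3 * k\<^sup>2)"
      unfolding Y3 k by (simp add: power2_eq_square algebra_simps)
    have "0 < (Y 1)\<^sup>2 + ((Y 2)\<^sup>2 + (Y 3)\<^sup>2)"
      using nz by (smt (verit) zero_le_power2 zero_less_power2)
    then have "1 \<le> (Y 2)\<^sup>2 - 3 * (k * Y 2) + 3 * k\<^sup>2"
      unfolding sq int_one_le_iff_zero_less zero_less_mult_iff by simp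
    then show ?thesis unfolding three using sq by simp
  qed
  have "relation_vector ?a \<in> minimal_vectors G n g"
  proof (rule minimal_vectorsI[where q = 6])
    show "relation_vector ?a \<in> group_lattice G n g"
      using t by (intro relation_vector_in_lattice) auto
    show "(\<Sum>i=1..n+1. (relation_vector ?a i)\<^sup>2) = 6"
      unfolding r v three by simp
  qed (use least in auto)
  moreover have "relation_vector ?b \<in> minimal_vectors G n g"
  proof (rule minimal_vectorsI[where q = 6])
    show "relation_vector ?b \<in> group_lattice G n g"
      using t ttt by (intro relation_vector_in_lattice) auto
    show "(\<Sum>i=1..n+1. (relation_vector ?b i)\<^sup>2) = 6"
      unfolding r v three by simp
  qed (use least in auto)
  moreover have "additive_mod (span (relation_vector ` ?R)) (carrier G)"
    unfolding t(3)[symmetric]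
  proof (rule additive_mod_cyclic[OF t(1,4) subspace_span])
    have ab: "relation_vector ?a \<in> span (relation_vector ` ?R)" "relation_vector ?b \<in> span (relation_vector ` ?R)"
      by (intro span_base; simp)+
    fix j :: nat assume "0 < j" "j < 3"
    then have "j = 1 \<or> j = Suc 1" by linarith
    then show "diff_vector (?t [^] j) + diff_vector ?t - diff_vector (?t [^] Suc j) \<in> span (relation_vector ` ?R)"
      using ab t(1) ttt by (auto simp: f_one)
  qed
  ultimately show ?thesis using n by (intro that[of ?R]) (auto simp: card_insert_if)
qed

text \<open>The empty family works: \<open>min_distance\<close> is unspecified here, and inclusion
  in the minimal vectors holds vacuously.\<close>

lemma minimal_relations_order_1:
  assumes n: "n = 0"
  obtains R where "finite R" "card R \<le> n" "relation_vector ` R \<subseteq> minimal_vectors G n g"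
    "additive_mod (span (relation_vector ` R)) (carrier G)"
proof -
  obtain b where "carrier G = {b}" using order n by (auto simp: order_def card_1_singleton_iff)
  then have c: "carrier G = {\<one>}" using one_closed by auto
  have "additive_mod (span (relation_vector ` {})) (carrier G)"
    unfolding c by (rule additive_mod_one[OF subspace_span])
  then show ?thesis by (intro that[of "{}"]) auto
qed

end

theorem theorem1p3:
  fixes G :: "('a, 'b) monoid_scheme" and n :: nat and g :: "nat \<Rightarrow> 'a"
  assumes "comm_group G"
    and "finite (carrier G)"
    and "order G = n + 1"
    and "bij_betw g {1..n} (carrier G - {\<one>\<^bsub>G\<^esub>})"
    and "\<not> G \<cong> integer_mod_group 4"
  shows "\<exists>B. B \<subseteq> minimal_vectors G n g \<and> finite B \<and> card B = n \<and>
           (\<forall>X \<in> group_lattice G n g. \<exists>c :: (nat \<Rightarrow> int) \<Rightarrow> int.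
              X = (\<lambda>i. \<Sum>b\<in>B. c b * b i))"
proof -
  interpret enumerated_group G n g
    using assms(1,3,4) by (intro enumerated_group.intro enumerated_group_axioms.intro)
  \<comment> \<open>The minimal squared norm is 8 for order 2, 6 for order 3 and 4 from order 4 on,
    apart from the excluded Z_4.\<close>
  consider "n = 0" | "n = 1" | "n = 2" | "3 \<le> n" by linarith
  then show ?thesis
  proof cases
    case 1
    then show ?thesis by (rule minimal_relations_order_1) (rule minimal_basis)
  next
    case 2
    then show ?thesis by (rule minimal_relations_order_2) (rule minimal_basis)
  next
    case 3
    then show ?thesis by (rule minimal_relations_order_3) (rule minimal_basis)
  next
    case 4
    then show ?thesis using assms(5) by (rule minimal_relations_large) (rule minimal_basis)
  qed
qed

end
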